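(* Let $S=K[x_1,\dots,x_n]$ be a polynomial ring over a field $K$ and let $I\subset S$ be a monomial ideal generated in a single degree $d$. Assume that the socle $\mathrm{soc}(I^k)$ of $I^k$ is generated in degree $dk-1$ for all $k\gg0$. Then $$\mathrm{HS}_{n-1}(I^{k+1})=I\cdot\mathrm{HS}_{n-1}(I^k)$$ for all $k\gg0$.
   Context: For $\mathbf a=(a_1,\dots,a_n)\in\mathbb Z_{\ge0}^n$ write $\mathbf x^{\mathbf a}=x_1^{a_1}\cdots x_n^{a_n}$. For a monomial ideal $J\subset S$, the $i$th homological shift ideal of $J$ is the monomial ideal $$\mathrm{HS}_i(J)=(\mathbf x^{\mathbf a}\ :\ \mathrm{Tor}^S_i(K,J)_{\mathbf a}\neq 0),$$ where $\mathrm{Tor}^S_i(K,J)$ carries its natural $\mathbb Z^n$-grading and $K=S/(x_1,\dots,x_n)$. Let $\mathfrak m=(x_1,\dots,x_n)$. The socle of a monomial ideal $J\subset S$ is the ideal $\mathrm{soc}(J)=(\mathbf x^{\mathbf a}\ :\ ((J:\mathfrak m)/J)_{\mathbf a}\neq0)$, i.e. the ideal generated by all monomials $u\notin J$ such that $x_ju\in J$ for all $1\le j\le n$. *)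

theory Defs
  imports "HOL-Library.Poly_Mapping" "HOL-Library.Cardinality" "Jordan_Normal_Form.Matrix"
begin

text \<open>
  The polynomial ring \<open>S = K[x\<^sub>1, \<dots>, x\<^sub>n]\<close> is the convolution ring of finitely supported functions on
  exponent vectors; the variables are indexed by a finite type \<open>'n\<close>, so \<open>n = CARD('n) \<ge> 1\<close>.
\<close>

type_synonym 'n expo = "'n \<Rightarrow>\<^sub>0 nat"
type_synonym ('n, 'k) mpol = "('n \<Rightarrow>\<^sub>0 nat) \<Rightarrow>\<^sub>0 'k"

definition mdeg :: "'n::finite expo \<Rightarrow> nat"
  where "mdeg a = (\<Sum>j\<in>UNIV. Poly_Mapping.lookup a j)"

definition xpow :: "'n expo \<Rightarrow> ('n, 'k::field) mpol"
  where "xpow a = Poly_Mapping.single a 1"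

definition var :: "'n \<Rightarrow> ('n, 'k::field) mpol"
  where "var j = xpow (Poly_Mapping.single j 1)"

definition homog :: "'n expo \<Rightarrow> ('n, 'k::field) mpol \<Rightarrow> bool"
  where "homog a f \<longleftrightarrow> Poly_Mapping.keys f \<subseteq> {a}"


section \<open>Ideals\<close>

global_interpretation mult_module: Modules.module "(*) :: 'a::comm_ring_1 \<Rightarrow> 'a \<Rightarrow> 'a"
  defines ideal_gen = mult_module.span
  by standard (simp_all add: algebra_simps)

definition maxideal :: "('n, 'k::field) mpol set"
  where "maxideal = ideal_gen (range var)"

definition ideal_mult :: "'a::comm_ring_1 set \<Rightarrow> 'a set \<Rightarrow> 'a set"
  where "ideal_mult I J = ideal_gen {f * g | f g. f \<in> I \<and> g \<in> J}"

primrec ideal_pow :: "'a::comm_ring_1 set \<Rightarrow> nat \<Rightarrow> 'a set" where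
  "ideal_pow I 0 = UNIV"
| "ideal_pow I (Suc k) = ideal_mult I (ideal_pow I k)"

definition colon :: "'a::comm_ring_1 set \<Rightarrow> 'a set \<Rightarrow> 'a set"
  where "colon J I = {f. \<forall>g\<in>I. f * g \<in> J}"

text \<open>
  A monomial ideal generated in the single degree \<open>d\<close>.  The zero ideal, having the empty set of
  generators, is generated in every degree.  The degree is an integer so that \<open>dk - 1\<close> is meaningful
  for \<open>dk = 0\<close>.
\<close>

definition monomial_ideal_in_degree :: "int \<Rightarrow> ('n::finite, 'k::field) mpol set \<Rightarrow> bool"
  where "monomial_ideal_in_degree d J \<longleftrightarrow>
    (\<exists>A. (\<forall>a\<in>A. int (mdeg a) = d) \<and> J = ideal_gen (xpow ` A))"

text \<open>
  The \<open>a\<close>-th component of \<open>(J : \<mm>)/J\<close> is nonzero iff some element of \<open>J : \<mm>\<close> that is homogeneous of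
  multidegree \<open>a\<close> lies outside \<open>J\<close>.
\<close>

definition soc :: "('n, 'k::field) mpol set \<Rightarrow> ('n, 'k) mpol set"
  where "soc J = ideal_gen {xpow a | a. \<exists>f\<in>colon J maxideal. homog a f \<and> f \<notin> J}"


section \<open>Tor\<close>

text \<open>
  A complex \<open>\<dots> \<rightarrow> F\<^sub>2 \<rightarrow> F\<^sub>1 \<rightarrow> F\<^sub>0\<close> of multigraded free modules of finite rank: \<open>F\<^sub>i\<close> is \<open>S\<close> to the power
  \<open>rnk F i\<close>, its \<open>j\<close>-th basis vector has multidegree \<open>shift F i j\<close>, and the matrix \<open>dif F i\<close> is
  the differential from \<open>F\<^sub>i\<^sub>+\<^sub>1\<close> to \<open>F\<^sub>i\<close>.
\<close>

record (overloaded) ('n, 'k) gr_complex =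
  rnk :: "nat \<Rightarrow> nat"
  shift :: "nat \<Rightarrow> nat \<Rightarrow> 'n \<Rightarrow>\<^sub>0 nat"
  dif :: "nat \<Rightarrow> (('n \<Rightarrow>\<^sub>0 nat) \<Rightarrow>\<^sub>0 'k) mat"

definition homog_vec ::
    "('n, 'k::field) gr_complex \<Rightarrow> nat \<Rightarrow> 'n expo \<Rightarrow> ('n, 'k) mpol vec \<Rightarrow> bool"
  where "homog_vec F i a v \<longleftrightarrow>
    v \<in> carrier_vec (rnk F i) \<and>
    (\<forall>j<rnk F i. \<forall>m\<in>Poly_Mapping.keys (v $ j). m + shift F i j = a)"

definition graded_maps :: "('n, 'k::field) gr_complex \<Rightarrow> bool"
  where "graded_maps F \<longleftrightarrow>
    (\<forall>i. dif F i \<in> carrier_mat (rnk F i) (rnk F (Suc i)) \<and>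
      (\<forall>j<rnk F (Suc i). homog_vec F i (shift F (Suc i) j) (col (dif F i) j)))"

text \<open>
  \<open>F\<close> is a multigraded free resolution of \<open>K = S/\<mm>\<close>.  The augmentation from \<open>F\<^sub>0\<close> to \<open>S/\<mm>\<close> is given by a
  lift to \<open>S\<close>, namely \<open>v \<mapsto> e \<bullet> v\<close>; so its kernel is the set of \<open>v\<close> with \<open>e \<bullet> v \<in> \<mm>\<close>.
\<close>

definition free_resolution_K ::
    "('n, 'k::field) gr_complex \<Rightarrow> ('n, 'k) mpol vec \<Rightarrow> bool"
  where "free_resolution_K F e \<longleftrightarrow>
    graded_maps F \<and>
    e \<in> carrier_vec (rnk F 0) \<and> (\<forall>j<rnk F 0. homog (shift F 0 j) (e $ j)) \<and>
    (\<forall>s. \<exists>v\<in>carrier_vec (rnk F 0). e \<bullet> v - s \<in> maxideal) \<and>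
    {v \<in> carrier_vec (rnk F 0). e \<bullet> v \<in> maxideal}
      = {dif F 0 *\<^sub>v w | w. w \<in> carrier_vec (rnk F 1)} \<and>
    (\<forall>i. {v \<in> carrier_vec (rnk F (Suc i)). dif F i *\<^sub>v v = 0\<^sub>v (rnk F i)}
      = {dif F (Suc i) *\<^sub>v w | w. w \<in> carrier_vec (rnk F (Suc (Suc i)))})"

text \<open>
  The chain modules of \<open>F \<otimes> J\<close>, where \<open>F\<^sub>i \<otimes> J\<close> is the direct sum of \<open>rnk F i\<close> (shifted) copies of \<open>J\<close>,
  with its cycles and boundaries.
\<close>

definition tensor_chains ::
    "('n, 'k::field) gr_complex \<Rightarrow> ('n, 'k) mpol set \<Rightarrow> nat \<Rightarrow> ('n, 'k) mpol vec set"
  where "tensor_chains F J i = {v \<in> carrier_vec (rnk F i). \<forall>j<rnk F i. v $ j \<in> J}"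

definition tensor_cycles ::
    "('n, 'k::field) gr_complex \<Rightarrow> ('n, 'k) mpol set \<Rightarrow> nat \<Rightarrow> ('n, 'k) mpol vec set"
  where "tensor_cycles F J i = {v \<in> tensor_chains F J i.
    case i of 0 \<Rightarrow> True | Suc l \<Rightarrow> dif F l *\<^sub>v v = 0\<^sub>v (rnk F l)}"

definition tensor_boundaries ::
    "('n, 'k::field) gr_complex \<Rightarrow> ('n, 'k) mpol set \<Rightarrow> nat \<Rightarrow> ('n, 'k) mpol vec set"
  where "tensor_boundaries F J i = {dif F i *\<^sub>v w | w. w \<in> tensor_chains F J (Suc i)}"

text \<open>
  \<open>Tor\<^sub>i(K, J)\<^sub>a \<noteq> 0\<close>, where \<open>Tor\<^sub>i(K, J)\<close> is the \<open>i\<close>-th homology of \<open>F \<otimes> J\<close> for a multigraded free resolution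
  \<open>F\<close> of \<open>K\<close>; as usual, the choice of \<open>F\<close> (for instance the Koszul complex on the variables) does not
  matter.  The component is nonzero iff some cycle of multidegree \<open>a\<close> is not a boundary.
\<close>

definition Tor_nonzero :: "nat \<Rightarrow> ('n, 'k::field) mpol set \<Rightarrow> 'n expo \<Rightarrow> bool"
  where "Tor_nonzero i J a \<longleftrightarrow>
    (\<exists>F e. free_resolution_K F e \<and>
      (\<exists>v\<in>tensor_cycles F J i. homog_vec F i a v \<and> v \<notin> tensor_boundaries F J i))"

definition HS :: "nat \<Rightarrow> ('n, 'k::field) mpol set \<Rightarrow> ('n, 'k) mpol set"
  where "HS i J = ideal_gen {xpow a | a. Tor_nonzero i J a}"

end

theory Submission
  imports Defs "HOL-Library.Multiset"
begin

text \<open>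
  For \<open>n \<ge> 2\<close>, the exactness of the Koszul complex on the variables gives
  \<open>HS\<^sub>n\<^sub>-\<^sub>1(J) = x\<^sub>1\<dots>x\<^sub>n soc(J)\<close> for every monomial ideal \<open>J\<close>, so that one has to show
  \<open>soc(I\<^sup>k\<^sup>+\<^sup>1) = I soc(I\<^sup>k)\<close> for large \<open>k\<close>.  By hypothesis the socle monomials of \<open>I\<^sup>k\<close> are then exactly the
  \<open>u\<close> such that every \<open>x\<^sub>j u\<close> is a product of \<open>k\<close> generators of \<open>I\<close>.  Fix \<open>j\<close> and write \<open>x\<^sub>j u\<close> as such a
  product.  The multisets of generators arising in this way are closed under adding generators, so by
  Dickson's lemma the minimal ones among them have bounded size: once \<open>k\<close> is large, a generator can be
  removed from the product so that what remains still comes from a socle monomial.  For \<open>n = 1\<close> one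
  has \<open>HS\<^sub>0(J) = J\<close>, and there is nothing to show.
\<close>

text \<open>\<open>Tor_nonzero\<close> allows a different resolution for every multidegree, so a
  cycle that is not a boundary over an arbitrary resolution has to be carried to the Koszul complex;
  hence the comparison maps and homotopies. The converse only has to exhibit the Koszul complex. The
  comparison maps must be multigraded, since the transported cycle has to keep its multidegree; this
  is achieved by replacing arbitrary lifts by their components of the right multidegree. The
  hypothesis on the socle enters through a degree count: in general x_j u is a product of k
  generators times some monomial, and when u has degree dk - 1 that monomial is 1. Membership in the
  socle thus becomes a statement about multisets of generators. Recording the multiset for one
  variable x_j is enough, because x_j u determines u; the conditions for the other variables are
  inherited from the smaller socle monomial, to which generators are added.\<close>

text \<open>
  As a simplification rule, the associativity law of the interpretation in the definitions loops with
  the associativity of multiplication.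
\<close>

declare mult_module.scale_scale [simp del]

abbreviation "keys \<equiv> Poly_Mapping.keys"
abbreviation "lookup \<equiv> Poly_Mapping.lookup"

section \<open>Supports and coefficients of polynomials\<close>

lemma mpol_sum_single: "(\<Sum>m\<in>keys f. Poly_Mapping.single m (lookup f m)) = f"
  by (rule poly_mapping_eqI)
    (simp add: lookup_sum lookup_single when_def sum.delta in_keys_iff)

lemma single_eq_mult_xpow: "Poly_Mapping.single (a + b) c = Poly_Mapping.single b c * xpow a"
  by (simp add: xpow_def mult_single add.commute)

lemma keys_xpow [simp]: "keys (xpow a :: ('n, 'k::field) mpol) = {a}"
  by (simp add: xpow_def)

lemma keys_var [simp]: "keys (var j :: ('n, 'k::field) mpol) = {Poly_Mapping.single j 1}"
  by (simp add: var_def)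

lemma xpow_add: "xpow (a + b) = xpow a * xpow b"
  by (simp add: xpow_def mult_single)

text \<open>The coefficients are translated together with the exponents, so nothing cancels and the
  inclusion \<open>keys_mult\<close> becomes an equality.\<close>

lemma keys_xpow_mult:
  fixes f :: "('n, 'k::field) mpol"
  shows "keys (xpow a * f) = (+) a ` keys f"
proof -
  have l: "lookup (xpow a * f) (a + m) = lookup f m" for m
  proof -
    have "lookup (xpow a * f) (a + m) =
        Sum_any (\<lambda>k. lookup (xpow a :: ('n,'k) mpol) k * Sum_any (\<lambda>q. lookup f q when a + m = k + q))"
      by (simp add: lookup_mult)
    also have "\<dots> = Sum_any (\<lambda>k. Sum_any (\<lambda>q. lookup f q when a + m = a + q) when k = a)"
      by (rule Sum_any.cong) (auto simp: xpow_def lookup_single when_def)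
    also have "\<dots> = lookup f m" by simp
    finally show ?thesis .
  qed
  have "keys (xpow a * f) \<subseteq> (+) a ` keys f" using keys_mult[of "xpow a" f] by auto
  with l show ?thesis by (force simp: in_keys_iff)
qed

text \<open>Exponents are natural numbers, so 0 splits only as 0 + 0.\<close>

lemma lookup_mult_zero:
  fixes f g :: "('n, 'k::field) mpol"
  shows "lookup (f * g) 0 = lookup f 0 * lookup g 0"
proof -
  have "(0::'n expo) = k + q \<longleftrightarrow> k = 0 \<and> q = 0" for k q :: "'n expo"
    by (auto simp: poly_mapping_eq_iff lookup_add fun_eq_iff)
  then have "lookup (f * g) 0 = Sum_any (\<lambda>k. lookup f k * Sum_any (\<lambda>q. (lookup g q when k = 0) when q = 0))"
    unfolding lookup_mult by (intro Sum_any.cong arg_cong2[where f="(*)"]) (auto simp: when_def)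
  also have "\<dots> = Sum_any (\<lambda>k. (lookup f k * lookup g 0) when k = 0)"
    by (intro Sum_any.cong) (auto simp: when_def)
  finally show ?thesis by simp
qed

section \<open>Monomial ideals\<close>

text \<open>Exponents of the monomials in the ideal generated by \<open>A\<close>; \<open>A\<close>
  may be infinite or redundant.\<close>

definition up :: "'n expo set \<Rightarrow> 'n expo set"
  where "up A = {a + b | a b. a \<in> A}"

lemma subset_up: "A \<subseteq> up A"
  unfolding up_def by (metis (mono_tags, lifting) add.right_neutral mem_Collect_eq subsetI)

lemma up_add: "a \<in> up A \<Longrightarrow> a + b \<in> up A"
  unfolding up_def using add.assoc by blast

lemma up_add': "a \<in> up A \<Longrightarrow> b + a \<in> up A"
  using up_add by (metis add.commute)

text \<open>A condition on supports defines an ideal, and a polynomial is the sum of its terms. This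
  turns questions about monomial ideals into questions about sets of exponents.\<close>

lemma ideal_gen_xpow:
  "ideal_gen (xpow ` A :: ('n, 'k::field) mpol set) = {f. keys f \<subseteq> up A}"
proof
  have "mult_module.subspace {f :: ('n, 'k) mpol. keys f \<subseteq> up A}"
  proof (rule mult_module.subspaceI)
    fix f g :: "('n, 'k) mpol"
    assume "g \<in> {f. keys f \<subseteq> up A}"
    then show "f * g \<in> {f. keys f \<subseteq> up A}" using keys_mult[of f g] up_add' by blast
  next
    fix f g :: "('n, 'k) mpol"
    assume "f \<in> {f. keys f \<subseteq> up A}" "g \<in> {f. keys f \<subseteq> up A}"
    then show "f + g \<in> {f. keys f \<subseteq> up A}" using Poly_Mapping.keys_add[of f g] by blast
  qed simp
  then show "ideal_gen (xpow ` A :: ('n, 'k::field) mpol set) \<subseteq> {f. keys f \<subseteq> up A}"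
    by (rule mult_module.span_minimal[rotated]) (auto intro: subsetD[OF subset_up])
next
  show "{f. keys f \<subseteq> up A} \<subseteq> ideal_gen (xpow ` A :: ('n, 'k::field) mpol set)"
  proof
    fix f :: "('n, 'k) mpol" assume f: "f \<in> {f. keys f \<subseteq> up A}"
    have "Poly_Mapping.single m (lookup f m) \<in> ideal_gen (xpow ` A)" if "m \<in> keys f" for m
    proof -
      from that f obtain a b where "a \<in> A" "m = a + b" by (auto simp: up_def)
      then show ?thesis
        by (simp add: single_eq_mult_xpow mult_module.span_scale mult_module.span_base)
    qed
    then have "(\<Sum>m\<in>keys f. Poly_Mapping.single m (lookup f m)) \<in> ideal_gen (xpow ` A)"
      by (rule mult_module.span_sum)
    then show "f \<in> ideal_gen (xpow ` A)" by (simp add: mpol_sum_single)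
  qed
qed

text \<open>Bilinearity is used one factor at a time: \<open>left\<close> fixes a generator of the
  second ideal, the second induction an element of the first.\<close>

lemma ideal_gen_mult:
  "ideal_mult (ideal_gen X) (ideal_gen Y) = ideal_gen {x * y | x y. x \<in> X \<and> y \<in> Y}"
    (is "_ = ideal_gen ?XY")
  for X Y :: "'a::comm_ring_1 set"
proof -
  have scale: "f * z \<in> ideal_gen ?XY" if "z \<in> ideal_gen ?XY" for f z
    using that by (rule mult_module.span_scale)
  have "f * y \<in> ideal_gen ?XY" if "f \<in> ideal_gen X" "y \<in> Y" for f y
    using that(1)
  proof (induction rule: mult_module.span_induct_alt)
    case base
    then show ?case by (simp add: mult_module.span_zero)
  next
    case (step c x f)
    have "x * y \<in> ideal_gen ?XY" using step(1) that(2) by (auto intro!: mult_module.span_base)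
    then have "c * (x * y) + f * y \<in> ideal_gen ?XY"
      by (rule mult_module.span_add[OF scale step(2)])
    moreover have "(c * x + f) * y = c * (x * y) + f * y" by (simp add: distrib_right mult.assoc)
    ultimately show ?case by (simp only:)
  qed
  note left = this
  have "f * g \<in> ideal_gen ?XY" if "f \<in> ideal_gen X" "g \<in> ideal_gen Y" for f g
    using that(2)
  proof (induction rule: mult_module.span_induct_alt)
    case base
    then show ?case by (simp add: mult_module.span_zero)
  next
    case (step c y g)
    have "c * (f * y) + f * g \<in> ideal_gen ?XY"
      by (rule mult_module.span_add[OF scale[OF left[OF that(1) step(1)]] step(2)])
    moreover have "f * (c * y + g) = c * (f * y) + f * g" by (simp add: distrib_left mult.left_commute)
    ultimately show ?case by (simp only:)
  qed
  then have "{f * g | f g. f \<in> ideal_gen X \<and> g \<in> ideal_gen Y} \<subseteq> ideal_gen ?XY" by blast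
  then have "ideal_mult (ideal_gen X) (ideal_gen Y) \<subseteq> ideal_gen ?XY"
    unfolding ideal_mult_def by (rule mult_module.span_minimal) (rule mult_module.subspace_span)
  moreover have "ideal_gen ?XY \<subseteq> ideal_mult (ideal_gen X) (ideal_gen Y)"
    unfolding ideal_mult_def
    by (rule mult_module.span_mono)
      (use subsetD[OF mult_module.span_superset[of X]] subsetD[OF mult_module.span_superset[of Y]]
       in fast)
  ultimately show ?thesis by (rule Set.equalityI)
qed

definition sumset :: "'n expo set \<Rightarrow> 'n expo set \<Rightarrow> 'n expo set"
  where "sumset A B = {a + b | a b. a \<in> A \<and> b \<in> B}"

lemma ideal_mult_xpow:
  "ideal_mult (ideal_gen (xpow ` A)) (ideal_gen (xpow ` B)) =
     (ideal_gen (xpow ` sumset A B) :: ('n, 'k::field) mpol set)"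
proof -
  have "{x * y | x y. x \<in> (xpow ` A :: ('n, 'k) mpol set) \<and> y \<in> xpow ` B} =
      (\<lambda>(a, b). xpow a * xpow b) ` (A \<times> B)" by fast
  moreover have "sumset A B = (\<lambda>(a, b). a + b) ` (A \<times> B)" unfolding sumset_def by fast
  ultimately have "{x * y | x y. x \<in> (xpow ` A :: ('n, 'k) mpol set) \<and> y \<in> xpow ` B} =
      xpow ` sumset A B"
    by (simp only: image_image split_def xpow_add)
  then show ?thesis unfolding ideal_gen_mult by (rule arg_cong)
qed

lemma ex_single_add:
  fixes m :: "'n expo"
  assumes "m \<noteq> 0"
  obtains j b where "m = Poly_Mapping.single j 1 + b"
proof -
  from assms obtain j where "lookup m j \<noteq> 0" by (metis lookup_zero poly_mapping_eqI)
  then have "m = Poly_Mapping.single j 1 + (m - Poly_Mapping.single j 1)"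
    by (intro poly_mapping_eqI) (auto simp: lookup_add lookup_minus lookup_single when_def)
  then show ?thesis by (rule that)
qed

lemma up_variables: "up (range (\<lambda>j. Poly_Mapping.single j 1)) = {m. m \<noteq> (0 :: 'n expo)}"
proof (rule Set.set_eqI, rule iffI)
  fix m :: "'n expo" assume "m \<in> up (range (\<lambda>j. Poly_Mapping.single j 1))"
  then obtain j b where "m = Poly_Mapping.single j 1 + b" by (auto simp: up_def)
  then have "lookup m j \<noteq> 0" by (simp add: lookup_add)
  then show "m \<in> {m. m \<noteq> 0}" by auto
next
  fix m :: "'n expo" assume "m \<in> {m. m \<noteq> 0}"
  then have "m \<noteq> 0" by blast
  then obtain j b where "m = Poly_Mapping.single j 1 + b" by (rule ex_single_add)
  then show "m \<in> up (range (\<lambda>j. Poly_Mapping.single j 1))"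
    unfolding up_def by blast
qed

lemma maxideal_eq: "maxideal = {f :: ('n, 'k::field) mpol. lookup f 0 = 0}"
proof -
  have "range (var :: 'n \<Rightarrow> ('n, 'k) mpol) = xpow ` range (\<lambda>j. Poly_Mapping.single j 1)"
    by (simp add: var_def image_image)
  moreover have "keys f \<subseteq> {m. m \<noteq> 0} \<longleftrightarrow> lookup f 0 = 0" for f :: "('n, 'k) mpol"
    using in_keys_iff[of 0 f] by blast
  ultimately show ?thesis unfolding maxideal_def by (simp only: ideal_gen_xpow up_variables)
qed

definition socle_exps :: "'n expo set \<Rightarrow> 'n expo set"
  where "socle_exps A = {b. b \<notin> up A \<and> (\<forall>j. b + Poly_Mapping.single j 1 \<in> up A)}"

text \<open>The multigraded components of S are one-dimensional, so a nonzero homogeneous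
  \<open>f\<close> is a nonzero constant times \<open>xpow b\<close> and only \<open>b\<close>
  matters.\<close>

lemma socle_exps_iff:
  fixes f :: "('n, 'k::field) mpol"
  assumes "homog b f"
  shows "f \<in> colon (ideal_gen (xpow ` A)) maxideal \<and> f \<notin> ideal_gen (xpow ` A)
    \<longleftrightarrow> f \<noteq> 0 \<and> b \<in> socle_exps A"
proof (cases "f = 0")
  case True
  then show ?thesis using mult_module.span_zero by blast
next
  case False
  have "keys f \<noteq> {}" using False by simp
  with assms have k: "keys f = {b}" unfolding homog_def by blast
  define c where "c = lookup f b"
  have c0: "c \<noteq> 0" using k by (auto simp: c_def in_keys_iff)
  have f: "f = Poly_Mapping.single b c"
    using mpol_sum_single[of f] k by (simp add: c_def)
  have "b + Poly_Mapping.single j 1 \<in> up A" if "f \<in> colon (ideal_gen (xpow ` A)) maxideal" for j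
  proof -
    have "var j \<in> (maxideal :: ('n, 'k) mpol set)"
      by (auto simp: maxideal_def intro: mult_module.span_base)
    with that have "f * var j \<in> ideal_gen (xpow ` A)" by (auto simp: colon_def)
    moreover have "f * var j = Poly_Mapping.single (b + Poly_Mapping.single j 1) c"
      by (simp add: f var_def xpow_def mult_single)
    ultimately show ?thesis using c0 by (simp add: ideal_gen_xpow)
  qed
  moreover have "f \<in> colon (ideal_gen (xpow ` A)) maxideal"
    if b: "b \<in> socle_exps A"
    unfolding colon_def
  proof (intro CollectI ballI)
    fix g :: "('n, 'k) mpol" assume "g \<in> maxideal"
    then have g: "0 \<notin> keys g" by (simp add: maxideal_eq in_keys_iff)
    have "m \<in> up A" if m: "m \<in> keys (f * g)" for m
    proof -
      obtain n where n: "m = b + n" "n \<in> keys g" using subsetD[OF keys_mult m] unfolding k by blast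
      with g have "n \<noteq> 0" by blast
      then obtain j q where "n = Poly_Mapping.single j 1 + q" by (rule ex_single_add)
      then have "m = (b + Poly_Mapping.single j 1) + q" using n by (simp add: add.assoc)
      then show ?thesis using b up_add unfolding socle_exps_def by blast
    qed
    then show "f * g \<in> ideal_gen (xpow ` A)" by (auto simp: ideal_gen_xpow)
  qed
  moreover have "f \<in> ideal_gen (xpow ` A) \<longleftrightarrow> b \<in> up A" by (simp add: ideal_gen_xpow k)
  ultimately show ?thesis using False unfolding socle_exps_def by blast
qed

lemma soc_eq:
  "soc (ideal_gen (xpow ` A) :: ('n, 'k::field) mpol set) = ideal_gen (xpow ` socle_exps A)"
proof -
  have "(\<exists>f :: ('n, 'k) mpol. f \<in> colon (ideal_gen (xpow ` A)) maxideal \<and> homog a f \<and>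
      f \<notin> ideal_gen (xpow ` A)) \<longleftrightarrow> a \<in> socle_exps A" for a
  proof
    assume "\<exists>f :: ('n, 'k) mpol. f \<in> colon (ideal_gen (xpow ` A)) maxideal \<and> homog a f \<and>
      f \<notin> ideal_gen (xpow ` A)"
    then obtain f :: "('n, 'k) mpol" where "f \<in> colon (ideal_gen (xpow ` A)) maxideal"
      "homog a f" "f \<notin> ideal_gen (xpow ` A)" by blast
    then show "a \<in> socle_exps A" using socle_exps_iff[of a f A] by blast
  next
    assume "a \<in> socle_exps A"
    moreover have "homog a (xpow a :: ('n, 'k) mpol)" by (simp add: homog_def)
    moreover have "(xpow a :: ('n, 'k) mpol) \<noteq> 0" by (metis insert_not_empty keys_xpow keys_zero)
    ultimately show "\<exists>f :: ('n, 'k) mpol. f \<in> colon (ideal_gen (xpow ` A)) maxideal \<and>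
      homog a f \<and> f \<notin> ideal_gen (xpow ` A)"
      using socle_exps_iff[of a "xpow a :: ('n, 'k) mpol" A] by (intro exI[of _ "xpow a"]) simp
  qed
  then have "{xpow a | a. \<exists>f\<in>colon (ideal_gen (xpow ` A)) maxideal. homog a f \<and>
      f \<notin> (ideal_gen (xpow ` A) :: ('n, 'k) mpol set)} = xpow ` socle_exps A"
    by (intro Set.set_eqI) (auto simp: Bex_def image_iff)
  then show ?thesis unfolding soc_def by (rule arg_cong)
qed


section \<open>Graded maps and multigraded components\<close>

text \<open>The condition that \<open>graded_maps\<close> puts on differentials, freed from a single
  complex and consecutive degrees, so that comparison maps and composites are covered as
  well.\<close>

definition graded_mat ::
    "('n, 'k::field) gr_complex \<Rightarrow> nat \<Rightarrow> ('n, 'k) gr_complex \<Rightarrow> nat \<Rightarrow> ('n, 'k) mpol mat \<Rightarrow> bool"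
  where "graded_mat F i G k M \<longleftrightarrow> M \<in> carrier_mat (rnk G k) (rnk F i) \<and>
    (\<forall>j<rnk F i. homog_vec G k (shift F i j) (col M j))"

lemma graded_matD:
  assumes "graded_mat F i G k M"
  shows "M \<in> carrier_mat (rnk G k) (rnk F i)"
    and "j < rnk F i \<Longrightarrow> homog_vec G k (shift F i j) (col M j)"
    and "r < rnk G k \<Longrightarrow> j < rnk F i \<Longrightarrow> m \<in> keys (M $$ (r, j)) \<Longrightarrow> m + shift G k r = shift F i j"
proof -
  show M: "M \<in> carrier_mat (rnk G k) (rnk F i)"
    and c: "j < rnk F i \<Longrightarrow> homog_vec G k (shift F i j) (col M j)" for j
    using assms by (auto simp: graded_mat_def)
  show "m + shift G k r = shift F i j"
    if "r < rnk G k" "j < rnk F i" "m \<in> keys (M $$ (r, j))" for r j m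
    using c[OF that(2)] that M unfolding homog_vec_def by auto
qed

lemma mult_mat_vec_index_sum:
  assumes "M \<in> carrier_mat p q" "v \<in> carrier_vec q" "r < p"
  shows "(M *\<^sub>v v) $ r = (\<Sum>j<q. M $$ (r, j) * v $ j)"
  using assms by (auto simp: scalar_prod_def atLeast0LessThan intro!: sum.cong)

lemma mult_unit_vec:
  fixes M :: "'a::semiring_1 mat"
  assumes "M \<in> carrier_mat p q" "j < q"
  shows "M *\<^sub>v unit_vec q j = col M j"
proof -
  have "col (M * 1\<^sub>m q) j = M *\<^sub>v col (1\<^sub>m q) j"
    by (rule col_mult2[OF assms(1) one_carrier_mat assms(2)])
  then show ?thesis using right_mult_one_mat[OF assms(1)] assms(2) by simp
qed

lemma homog_vec_mult_mat:
  assumes M: "graded_mat F i G k M" and v: "homog_vec F i a v"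
  shows "homog_vec G k a (M *\<^sub>v v)"
proof -
  have vc: "v \<in> carrier_vec (rnk F i)" using v by (simp add: homog_vec_def)
  note Mc = graded_matD(1)[OF M]
  have "m + shift G k r = a" if r: "r < rnk G k" and m: "m \<in> keys ((M *\<^sub>v v) $ r)" for r m
  proof -
    from m obtain j where j: "j < rnk F i" "m \<in> keys (M $$ (r, j) * v $ j)"
      using Poly_Mapping.keys_sum[of "\<lambda>j. M $$ (r, j) * v $ j" "{..<rnk F i}"]
      unfolding mult_mat_vec_index_sum[OF Mc vc r] by blast
    then obtain p q where pq: "m = p + q" "p \<in> keys (M $$ (r, j))" "q \<in> keys (v $ j)"
      using keys_mult[of "M $$ (r, j)" "v $ j"] by blast
    have "p + shift G k r = shift F i j" using graded_matD(3)[OF M r j(1) pq(2)] .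
    moreover have "q + shift F i j = a" using v j(1) pq(3) by (auto simp: homog_vec_def)
    ultimately show ?thesis by (metis pq(1) add.assoc add.commute)
  qed
  then show ?thesis using Mc vc by (simp add: homog_vec_def)
qed

lemma graded_mat_mult:
  assumes "graded_mat G k H l N" "graded_mat F i G k M"
  shows "graded_mat F i H l (N * M)"
  unfolding graded_mat_def
proof (intro conjI allI impI)
  note N = graded_matD(1)[OF assms(1)] and M = graded_matD(1)[OF assms(2)]
  show "N * M \<in> carrier_mat (rnk H l) (rnk F i)" using N M by simp
  fix j assume j: "j < rnk F i"
  have "col (N * M) j = N *\<^sub>v col M j" by (rule col_mult2[OF N M j])
  then show "homog_vec H l (shift F i j) (col (N * M) j)"
    using homog_vec_mult_mat[OF assms(1) graded_matD(2)[OF assms(2) j]] by simp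
qed

section \<open>Projections onto multigraded components\<close>

text \<open>A predicate is used because the component of multidegree a in a copy of S shifted by s
  is selected by \<open>m + s = a\<close>; a difference of exponents would be truncated.\<close>

definition mpart :: "('n expo \<Rightarrow> bool) \<Rightarrow> ('n, 'k::field) mpol \<Rightarrow> ('n, 'k) mpol"
  where "mpart P f = Poly_Mapping.mapp (\<lambda>m c. c when P m) f"

lemma lookup_mpart: "lookup (mpart P f) m = (lookup f m when P m)"
  by (auto simp: mpart_def lookup_mapp in_keys_iff when_def)

lemma keys_mpart: "keys (mpart P f) = {m \<in> keys f. P m}"
  by (auto simp: in_keys_iff lookup_mpart when_def split: if_splits)

lemma mpart_eq: "(\<And>m. m \<in> keys f \<Longrightarrow> P m) \<Longrightarrow> mpart P f = f"
  by (rule poly_mapping_eqI) (auto simp: lookup_mpart when_def in_keys_iff)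

lemma mpart_eq_0: "(\<And>m. m \<in> keys f \<Longrightarrow> \<not> P m) \<Longrightarrow> mpart P f = 0"
  by (rule poly_mapping_eqI) (auto simp: lookup_mpart when_def in_keys_iff)

lemma mpart_add: "mpart P (f + g) = mpart P f + mpart P g"
  by (rule poly_mapping_eqI) (auto simp: lookup_mpart when_def lookup_add)

lemma mpart_sum: "mpart P (sum f A) = (\<Sum>x\<in>A. mpart P (f x))"
  by (rule poly_mapping_eqI) (auto simp: lookup_mpart when_def lookup_sum)

lemma mpart_mult:
  fixes f g :: "('n, 'k::field) mpol"
  assumes "\<And>m. m \<in> keys f \<Longrightarrow> m + s = t"
  shows "mpart (\<lambda>m. m + s = a) (f * g) = f * mpart (\<lambda>m. m + t = a) g"
proof -
  \<comment> \<open>The product of \<open>f\<close> with \<open>g1\<close> lies entirely in the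
    selected component, that with \<open>g2\<close> entirely outside.\<close>
  define g1 where "g1 = mpart (\<lambda>m. m + t = a) g"
  define g2 where "g2 = mpart (\<lambda>m. m + t \<noteq> a) g"
  have g: "g = g1 + g2"
    by (rule poly_mapping_eqI) (simp add: g1_def g2_def lookup_add lookup_mpart when_def)
  have shift: "\<exists>q\<in>keys h. m + s = q + t" if m: "m \<in> keys (f * h)" for m and h :: "('n, 'k) mpol"
  proof -
    obtain p q where pq: "m = p + q" "p \<in> keys f" "q \<in> keys h"
      using subsetD[OF keys_mult m] by blast
    then have "m + s = q + t" using assms[OF pq(2)] by (metis add.assoc add.commute)
    with pq(3) show ?thesis by blast
  qed
  have "mpart (\<lambda>m. m + s = a) (f * g1) = f * g1"
  proof (rule mpart_eq)
    fix m assume "m \<in> keys (f * g1)"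
    from shift[OF this] show "m + s = a" by (auto simp: g1_def keys_mpart)
  qed
  moreover have "mpart (\<lambda>m. m + s = a) (f * g2) = 0"
  proof (rule mpart_eq_0)
    fix m assume "m \<in> keys (f * g2)"
    from shift[OF this] show "m + s \<noteq> a" by (auto simp: g2_def keys_mpart)
  qed
  moreover have "f * g = f * g1 + f * g2" by (subst g) (rule distrib_left)
  ultimately have "mpart (\<lambda>m. m + s = a) (f * g) = f * g1" by (simp add: mpart_add)
  then show ?thesis by (simp only: g1_def)
qed

definition hpart ::
    "('n, 'k::field) gr_complex \<Rightarrow> nat \<Rightarrow> 'n expo \<Rightarrow> ('n, 'k) mpol vec \<Rightarrow> ('n, 'k) mpol vec"
  where "hpart F i a v = vec (rnk F i) (\<lambda>j. mpart (\<lambda>m. m + shift F i j = a) (v $ j))"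

lemma hpart_carrier [simp]: "hpart F i a v \<in> carrier_vec (rnk F i)"
  by (simp add: hpart_def)

lemma homog_vec_hpart: "homog_vec F i a (hpart F i a v)"
  by (auto simp: homog_vec_def hpart_def keys_mpart)

lemma hpart_eq: "homog_vec F i a v \<Longrightarrow> hpart F i a v = v"
  by (rule eq_vecI) (auto simp: hpart_def homog_vec_def intro!: mpart_eq)

text \<open>Entry by entry this is \<open>mpart_mult\<close>. It allows preimages of homogeneous
  vectors to be made homogeneous.\<close>

lemma mult_mat_hpart:
  assumes M: "graded_mat F i G k M" and v: "v \<in> carrier_vec (rnk F i)"
  shows "M *\<^sub>v hpart F i a v = hpart G k a (M *\<^sub>v v)"
proof (rule eq_vecI)
  note Mc = graded_matD(1)[OF M]
  show "dim_vec (M *\<^sub>v hpart F i a v) = dim_vec (hpart G k a (M *\<^sub>v v))"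
    using Mc by (simp add: hpart_def)
  fix r assume "r < dim_vec (hpart G k a (M *\<^sub>v v))"
  then have r: "r < rnk G k" by (simp add: hpart_def)
  have "(M *\<^sub>v hpart F i a v) $ r =
      (\<Sum>j<rnk F i. M $$ (r, j) * mpart (\<lambda>m. m + shift F i j = a) (v $ j))"
    unfolding mult_mat_vec_index_sum[OF Mc hpart_carrier r] by (simp add: hpart_def)
  also have "\<dots> = (\<Sum>j<rnk F i. mpart (\<lambda>m. m + shift G k r = a) (M $$ (r, j) * v $ j))"
    using graded_matD(3)[OF M r] by (intro sum.cong refl mpart_mult[symmetric]) auto
  also have "\<dots> = hpart G k a (M *\<^sub>v v) $ r"
    using r by (simp add: hpart_def mult_mat_vec_index_sum[OF Mc v] mpart_sum)
  finally show "(M *\<^sub>v hpart F i a v) $ r = hpart G k a (M *\<^sub>v v) $ r" .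
qed

lemma exists_mat_columns:
  assumes "\<And>j. j < q \<Longrightarrow> \<exists>w\<in>carrier_vec p. R j w"
  shows "\<exists>W\<in>carrier_mat p q. \<forall>j<q. R j (col W j)"
proof -
  obtain w where w: "\<And>j. j < q \<Longrightarrow> w j \<in> carrier_vec p \<and> R j (w j)" using assms by metis
  define W where "W = mat p q (\<lambda>(i, j). w j $ i)"
  have "col W j = w j" if "j < q" for j
    using w[OF that] that by (intro eq_vecI) (auto simp: W_def)
  with w show ?thesis by (intro bexI[of _ W]) (auto simp: W_def)
qed

text \<open>A map out of a free module is given by arbitrary images of the basis vectors.
  \<open>R\<close> carries a side condition on the columns: homogeneity in
  \<open>lift_graded\<close>, nothing in the homotopy.\<close>

lemma lift_columns:
  assumes B: "B \<in> carrier_mat r p" and N: "N \<in> carrier_mat r q"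
    and lift: "\<And>j. j < q \<Longrightarrow> \<exists>w\<in>carrier_vec p. R j w \<and> B *\<^sub>v w = col N j"
  shows "\<exists>W\<in>carrier_mat p q. B * W = N \<and> (\<forall>j<q. R j (col W j))"
proof -
  obtain W where W: "W \<in> carrier_mat p q" "\<And>j. j < q \<Longrightarrow> R j (col W j) \<and> B *\<^sub>v col W j = col N j"
    using exists_mat_columns[of q p "\<lambda>j w. R j w \<and> B *\<^sub>v w = col N j", OF lift] by blast
  have "B * W = N"
  proof (rule mat_col_eqI)
    fix j assume "j < dim_col N"
    then have "j < q" using N by simp
    then show "col (B * W) j = col N j" using W B by simp
  qed (use B N W in auto)
  with W show ?thesis by blast
qed

text \<open>Projecting a preimage of a column to the multidegree of that column leaves it a
  preimage, as the column is itself homogeneous.\<close>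

lemma lift_graded:
  assumes B: "graded_mat H l G k B" and N: "graded_mat F i G k N"
    and lift: "\<And>j. j < rnk F i \<Longrightarrow> \<exists>w\<in>carrier_vec (rnk H l). B *\<^sub>v w = col N j"
  shows "\<exists>W. graded_mat F i H l W \<and> B * W = N"
proof -
  have "\<exists>w\<in>carrier_vec (rnk H l). homog_vec H l (shift F i j) w \<and> B *\<^sub>v w = col N j"
    if j: "j < rnk F i" for j
  proof -
    from lift[OF j] obtain w where w: "w \<in> carrier_vec (rnk H l)" "B *\<^sub>v w = col N j" by blast
    have "B *\<^sub>v hpart H l (shift F i j) w = col N j"
      using mult_mat_hpart[OF B w(1)] w(2) hpart_eq[OF graded_matD(2)[OF N j]] by simp
    then show ?thesis using homog_vec_hpart hpart_carrier by blast
  qed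
  from lift_columns[OF graded_matD(1)[OF B] graded_matD(1)[OF N], of "\<lambda>j. homog_vec H l (shift F i j)",
      OF this]
  show ?thesis unfolding graded_mat_def by blast
qed

section \<open>Independence of the resolution\<close>

text \<open>In degree 0 the augmentation takes the place of a differential, so the two exactness
  clauses of \<open>free_resolution_K\<close> get one form.\<close>

definition augmented_cycle ::
    "('n, 'k::field) gr_complex \<Rightarrow> ('n, 'k) mpol vec \<Rightarrow> nat \<Rightarrow> ('n, 'k) mpol vec \<Rightarrow> bool"
  where "augmented_cycle F e i v \<longleftrightarrow>
    (case i of 0 \<Rightarrow> e \<bullet> v \<in> maxideal | Suc l \<Rightarrow> dif F l *\<^sub>v v = 0\<^sub>v (rnk F l))"

lemma resolution_exact:
  assumes "free_resolution_K F e" "v \<in> carrier_vec (rnk F i)"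
  shows "augmented_cycle F e i v \<longleftrightarrow> (\<exists>w\<in>carrier_vec (rnk F (Suc i)). dif F i *\<^sub>v w = v)"
proof (cases i)
  case 0
  have "{v \<in> carrier_vec (rnk F 0). e \<bullet> v \<in> maxideal}
      = {dif F 0 *\<^sub>v w | w. w \<in> carrier_vec (rnk F 1)}"
    using assms(1) by (simp add: free_resolution_K_def)
  then have "v \<in> carrier_vec (rnk F 0) \<and> e \<bullet> v \<in> maxideal \<longleftrightarrow>
      (\<exists>w. v = dif F 0 *\<^sub>v w \<and> w \<in> carrier_vec (rnk F 1))" by blast
  then show ?thesis using assms(2) 0 unfolding augmented_cycle_def by auto
next
  case (Suc l)
  have "{v \<in> carrier_vec (rnk F (Suc l)). dif F l *\<^sub>v v = 0\<^sub>v (rnk F l)}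
      = {dif F (Suc l) *\<^sub>v w | w. w \<in> carrier_vec (rnk F (Suc (Suc l)))}"
    using assms(1) by (simp add: free_resolution_K_def)
  then have "v \<in> carrier_vec (rnk F (Suc l)) \<and> dif F l *\<^sub>v v = 0\<^sub>v (rnk F l) \<longleftrightarrow>
      (\<exists>w. v = dif F (Suc l) *\<^sub>v w \<and> w \<in> carrier_vec (rnk F (Suc (Suc l))))" by blast
  then show ?thesis using assms(2) Suc unfolding augmented_cycle_def by auto
qed

lemma resolution_graded:
  assumes "free_resolution_K F e"
  shows "graded_mat F (Suc i) F i (dif F i)"
  using assms unfolding free_resolution_K_def graded_maps_def graded_mat_def by blast

lemma resolution_carrier:
  assumes "free_resolution_K F e"
  shows "dif F i \<in> carrier_mat (rnk F i) (rnk F (Suc i))" "e \<in> carrier_vec (rnk F 0)"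
  using assms unfolding free_resolution_K_def graded_maps_def by blast+

lemma augmented_cycle_dif:
  assumes "free_resolution_K F e" "w \<in> carrier_vec (rnk F (Suc i))"
  shows "augmented_cycle F e i (dif F i *\<^sub>v w)"
  using resolution_exact[OF assms(1) mult_mat_vec_carrier[OF resolution_carrier(1)[OF assms(1)]
      assms(2)]] assms(2) by blast

lemma augmented_cycle_col_dif:
  assumes "free_resolution_K F e" "j < rnk F (Suc i)"
  shows "augmented_cycle F e i (col (dif F i) j)"
proof -
  have "augmented_cycle F e i (dif F i *\<^sub>v unit_vec (rnk F (Suc i)) j)"
    by (rule augmented_cycle_dif[OF assms(1) unit_vec_carrier])
  then show ?thesis using mult_unit_vec[OF resolution_carrier(1)[OF assms(1)] assms(2)] by simp
qed

text \<open>The vectors \<open>e\<close> and \<open>e'\<close> only lift the augmentations to S, so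
  compatibility with them is required modulo m.\<close>

definition chain_map where
  "chain_map F e G e' \<Phi> \<longleftrightarrow>
    (\<forall>i. graded_mat F i G i (\<Phi> i)) \<and>
    (\<forall>v\<in>carrier_vec (rnk F 0). e' \<bullet> (\<Phi> 0 *\<^sub>v v) - e \<bullet> v \<in> maxideal) \<and>
    (\<forall>i. dif G i * \<Phi> (Suc i) = \<Phi> i * dif F i)"

lemma subspace_maxideal: "mult_module.subspace maxideal"
  by (simp add: maxideal_def mult_module.subspace_span)

lemma scalar_prod_maxideal:
  assumes "x \<in> carrier_vec q" "v \<in> carrier_vec q" "\<And>j. j < q \<Longrightarrow> x $ j \<in> maxideal"
  shows "x \<bullet> v \<in> (maxideal :: ('n, 'k::field) mpol set)"
  using assms
  by (auto simp: scalar_prod_def mult.commute[of "x $ _"] intro!: mult_module.subspace_sum[OF subspace_maxideal]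
      mult_module.subspace_scale[OF subspace_maxideal])

text \<open>Comparison theorem, degree by degree. The invariant \<open>P\<close> includes that
  cycles go to cycles, which is what exactness of \<open>G\<close> needs in order to lift the next
  columns.\<close>

lemma exists_chain_map:
  assumes F: "free_resolution_K F e" and G: "free_resolution_K G e'"
  shows "\<exists>\<Phi>. chain_map F e G e' \<Phi>"
proof -
  define P where "P i X \<longleftrightarrow> graded_mat F i G i X \<and>
    (i = 0 \<longrightarrow> (\<forall>v\<in>carrier_vec (rnk F 0). e' \<bullet> (X *\<^sub>v v) - e \<bullet> v \<in> maxideal)) \<and>
    (\<forall>v\<in>carrier_vec (rnk F i). augmented_cycle F e i v \<longrightarrow> augmented_cycle G e' i (X *\<^sub>v v))"
    for i X
  note ec = resolution_carrier(2)[OF F] and e'c = resolution_carrier(2)[OF G]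
  have "\<exists>X. P 0 X"
  proof -
    have "\<exists>w\<in>carrier_vec (rnk G 0). homog_vec G 0 (shift F 0 j) w \<and> e' \<bullet> w - e $ j \<in> maxideal"
      if j: "j < rnk F 0" for j
    \<comment> \<open>The entries of \<open>e\<close> are homogeneous, so at a basis vector of
      nonzero multidegree the entry lies in m and 0 is a lift.\<close>
    proof (cases "shift F 0 j = 0")
      case False
      have "homog_vec G 0 (shift F 0 j) (0\<^sub>v (rnk G 0))" by (simp add: homog_vec_def)
      moreover have "homog (shift F 0 j) (e $ j)" using F j by (simp add: free_resolution_K_def)
      then have "- e $ j \<in> maxideal" using False unfolding homog_def maxideal_eq
        by (auto simp: in_keys_iff subset_iff)
      ultimately show ?thesis using e'c by (intro bexI[of _ "0\<^sub>v (rnk G 0)"]) auto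
    next
      case True
      obtain w where w: "w \<in> carrier_vec (rnk G 0)" "e' \<bullet> w - e $ j \<in> maxideal"
        using G unfolding free_resolution_K_def by blast
      \<comment> \<open>Dropping the other components keeps the constant term of
        \<open>e' \<bullet> w\<close>, because entries of \<open>e'\<close> in nonzero multidegree
        have constant term 0.\<close>
      define w0 where "w0 = hpart G 0 0 w"
      have w0c: "w0 \<in> carrier_vec (rnk G 0)" by (simp add: w0_def)
      have "lookup (e' $ l * w0 $ l) 0 = lookup (e' $ l * w $ l) 0" if l: "l < rnk G 0" for l
      proof (cases "shift G 0 l = 0")
        case True
        then have "lookup (w0 $ l) 0 = lookup (w $ l) 0"
          using l by (simp add: w0_def hpart_def lookup_mpart)
        then show ?thesis by (simp add: lookup_mult_zero)
      next
        case False
        have "homog (shift G 0 l) (e' $ l)" using G l by (simp add: free_resolution_K_def)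
        then have "lookup (e' $ l) 0 = 0" using False unfolding homog_def
          by (auto simp: in_keys_iff subset_iff)
        then show ?thesis by (simp add: lookup_mult_zero)
      qed
      then have "lookup (e' \<bullet> w0) 0 = lookup (e' \<bullet> w) 0"
        using w0c w(1) by (simp add: scalar_prod_def lookup_sum)
      then have "e' \<bullet> w0 - e $ j \<in> maxideal" using w(2) by (simp add: maxideal_eq lookup_minus)
      then show ?thesis using w0c True by (intro bexI[of _ w0]) (auto simp: w0_def homog_vec_hpart)
    qed
    from exists_mat_columns[of "rnk F 0" "rnk G 0"
        "\<lambda>j w. homog_vec G 0 (shift F 0 j) w \<and> e' \<bullet> w - e $ j \<in> maxideal", OF this]
    obtain X where X: "X \<in> carrier_mat (rnk G 0) (rnk F 0)"
      "\<And>j. j < rnk F 0 \<Longrightarrow> homog_vec G 0 (shift F 0 j) (col X j) \<and> e' \<bullet> col X j - e $ j \<in> maxideal"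
      by blast
    have aug: "e' \<bullet> (X *\<^sub>v v) - e \<bullet> v \<in> maxideal" if v: "v \<in> carrier_vec (rnk F 0)" for v
    proof -
      \<comment> \<open>\<open>y\<close> is the row vector e' X; its entries agree with those of
        \<open>e\<close> modulo m.\<close>
      define y where "y = vec (rnk F 0) (\<lambda>j. e' \<bullet> col X j)"
      have yc: "y \<in> carrier_vec (rnk F 0)" by (simp add: y_def)
      have "e' \<bullet> (X *\<^sub>v v) = y \<bullet> v"
      proof -
        have "e' \<bullet> (X *\<^sub>v v) = (\<Sum>l<rnk G 0. \<Sum>j<rnk F 0. e' $ l * (X $$ (l, j) * v $ j))"
          using X(1) v e'c mult_mat_vec_index_sum[OF X(1) v]
          by (simp add: scalar_prod_def atLeast0LessThan sum_distrib_left)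
        also have "\<dots> = (\<Sum>j<rnk F 0. \<Sum>l<rnk G 0. e' $ l * (X $$ (l, j) * v $ j))"
          by (rule sum.swap)
        also have "\<dots> = y \<bullet> v"
          using X(1) v by (auto simp: y_def scalar_prod_def atLeast0LessThan sum_distrib_right mult.assoc
              intro!: sum.cong)
        finally show ?thesis .
      qed
      then have "e' \<bullet> (X *\<^sub>v v) - e \<bullet> v = (y - e) \<bullet> v"
        using minus_scalar_prod_distrib[OF yc ec v] by simp
      also have "\<dots> \<in> maxideal"
        by (rule scalar_prod_maxideal[of _ "rnk F 0"]) (use X(2) yc ec v in \<open>auto simp: y_def\<close>)
      finally show ?thesis .
    qed
    have "augmented_cycle G e' 0 (X *\<^sub>v v)"
      if "v \<in> carrier_vec (rnk F 0)" "augmented_cycle F e 0 v" for v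
    proof -
      have "(e' \<bullet> (X *\<^sub>v v) - e \<bullet> v) + e \<bullet> v \<in> maxideal"
        using aug[OF that(1)] that(2)
        by (intro mult_module.subspace_add[OF subspace_maxideal]) (auto simp: augmented_cycle_def)
      then show ?thesis by (simp add: augmented_cycle_def)
    qed
    then have "P 0 X" using X aug by (auto simp: P_def graded_mat_def)
    then show ?thesis by blast
  qed
  moreover have "\<exists>Y. P (Suc i) Y \<and> dif G i * Y = X * dif F i" if X: "P i X" for X i
  proof -
    have Xg: "graded_mat F i G i X" using X by (simp add: P_def)
    note Xc = graded_matD(1)[OF Xg] and dc = resolution_carrier(1)[OF F, of i]
      and dc' = resolution_carrier(1)[OF G, of i]
    have "\<exists>w\<in>carrier_vec (rnk G (Suc i)). dif G i *\<^sub>v w = col (X * dif F i) j"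
      if j: "j < rnk F (Suc i)" for j
    proof -
      have "augmented_cycle G e' i (X *\<^sub>v col (dif F i) j)"
        using X augmented_cycle_col_dif[OF F j] col_carrier_vec[OF j dc] by (simp add: P_def)
      moreover have "X *\<^sub>v col (dif F i) j = col (X * dif F i) j"
        using col_mult2[OF Xc dc j] by simp
      ultimately show ?thesis
        using resolution_exact[OF G] col_carrier_vec[OF j mult_carrier_mat[OF Xc dc]] by simp
    qed
    from lift_graded[OF resolution_graded[OF G] graded_mat_mult[OF Xg resolution_graded[OF F]] this]
    obtain Y where Y: "graded_mat F (Suc i) G (Suc i) Y" "dif G i * Y = X * dif F i" by blast
    note Yc = graded_matD(1)[OF Y(1)]
    have "augmented_cycle G e' (Suc i) (Y *\<^sub>v v)"
      if v: "v \<in> carrier_vec (rnk F (Suc i))" and cyc: "augmented_cycle F e (Suc i) v" for v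
    proof -
      have "dif G i *\<^sub>v (Y *\<^sub>v v) = (dif G i * Y) *\<^sub>v v" using dc' Yc v by simp
      also have "\<dots> = X *\<^sub>v (dif F i *\<^sub>v v)" using Y(2) Xc dc v by simp
      also have "\<dots> = X *\<^sub>v 0\<^sub>v (rnk F i)" using cyc by (simp add: augmented_cycle_def)
      also have "\<dots> = 0\<^sub>v (rnk G i)" using Xc by auto
      finally show ?thesis by (simp add: augmented_cycle_def)
    qed
    with Y show ?thesis by (auto simp: P_def)
  qed
  ultimately obtain \<Phi> where "\<And>i. P i (\<Phi> i) \<and> dif G i * \<Phi> (Suc i) = \<Phi> i * dif F i"
    using dependent_nat_choice[of P "\<lambda>i X Y. dif G i * Y = X * dif F i"] by blast
  then have "chain_map F e G e' \<Phi>" unfolding chain_map_def P_def by blast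
  then show ?thesis by blast
qed

lemma chain_map_comp:
  assumes F: "free_resolution_K F e" and G: "free_resolution_K G e'" and H: "free_resolution_K H e''"
    and \<Phi>: "chain_map F e G e' \<Phi>" and \<Psi>: "chain_map G e' H e'' \<Psi>"
  shows "chain_map F e H e'' (\<lambda>i. \<Psi> i * \<Phi> i)"
proof -
  have g: "graded_mat F i G i (\<Phi> i)" "graded_mat G i H i (\<Psi> i)" for i
    using \<Phi> \<Psi> by (auto simp: chain_map_def)
  note c = graded_matD(1)[OF g(1)] graded_matD(1)[OF g(2)]
  note d = resolution_carrier(1)[OF F] resolution_carrier(1)[OF G] resolution_carrier(1)[OF H]
  have "e'' \<bullet> (\<Psi> 0 * \<Phi> 0 *\<^sub>v v) - e \<bullet> v \<in> maxideal" if v: "v \<in> carrier_vec (rnk F 0)" for v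
  proof -
    have w: "\<Phi> 0 *\<^sub>v v \<in> carrier_vec (rnk G 0)" by (rule mult_mat_vec_carrier[OF c(1) v])
    have "(e'' \<bullet> (\<Psi> 0 *\<^sub>v (\<Phi> 0 *\<^sub>v v)) - e' \<bullet> (\<Phi> 0 *\<^sub>v v)) + (e' \<bullet> (\<Phi> 0 *\<^sub>v v) - e \<bullet> v) \<in> maxideal"
      using \<Phi> \<Psi> v w by (intro mult_module.subspace_add[OF subspace_maxideal]) (auto simp: chain_map_def)
    then show ?thesis using assoc_mult_mat_vec[OF c(2) c(1) v] by simp
  qed
  moreover have "dif H i * (\<Psi> (Suc i) * \<Phi> (Suc i)) = \<Psi> i * \<Phi> i * dif F i" for i
  proof -
    have "dif H i * (\<Psi> (Suc i) * \<Phi> (Suc i)) = (dif H i * \<Psi> (Suc i)) * \<Phi> (Suc i)"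
      by (rule assoc_mult_mat[symmetric, OF d(3) c(2) c(1)])
    also have "\<dots> = \<Psi> i * dif G i * \<Phi> (Suc i)" using \<Psi> by (simp add: chain_map_def)
    also have "\<dots> = \<Psi> i * (dif G i * \<Phi> (Suc i))" by (rule assoc_mult_mat[OF c(2) d(2) c(1)])
    also have "\<dots> = \<Psi> i * (\<Phi> i * dif F i)" using \<Phi> by (simp add: chain_map_def)
    also have "\<dots> = \<Psi> i * \<Phi> i * dif F i" by (rule assoc_mult_mat[symmetric, OF c(2) c(1) d(1)])
    finally show ?thesis .
  qed
  ultimately show ?thesis using graded_mat_mult[OF g(2) g(1)] unfolding chain_map_def by blast
qed

text \<open>
  The matrix \<open>h\<close> is the degree \<open>i\<close> part of a homotopy between \<open>\<Theta>\<close> and the identity; on cycles the other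
  term of the homotopy relation vanishes.
\<close>

lemma chain_map_homotopy:
  assumes F: "free_resolution_K F e" and \<Theta>: "chain_map F e F e \<Theta>"
  shows "\<exists>h\<in>carrier_mat (rnk F (Suc i)) (rnk F i). \<forall>v\<in>carrier_vec (rnk F i).
    augmented_cycle F e i v \<longrightarrow> \<Theta> i *\<^sub>v v - v = dif F i *\<^sub>v (h *\<^sub>v v)"
proof -
  have c: "\<Theta> i \<in> carrier_mat (rnk F i) (rnk F i)" for i
    using \<Theta> graded_matD(1) unfolding chain_map_def by blast
  note d = resolution_carrier(1)[OF F] and ec = resolution_carrier(2)[OF F]
  have lift: "\<exists>h\<in>carrier_mat (rnk F (Suc i)) (rnk F i). dif F i * h = N"
    if N: "N \<in> carrier_mat (rnk F i) (rnk F i)"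
      and cyc: "\<And>j. j < rnk F i \<Longrightarrow> augmented_cycle F e i (col N j)" for N i
  proof -
    have "\<exists>w\<in>carrier_vec (rnk F (Suc i)). True \<and> dif F i *\<^sub>v w = col N j" if "j < rnk F i" for j
      using resolution_exact[OF F] cyc[OF that] col_carrier_vec[OF that N] by simp
    from lift_columns[OF d N, of "\<lambda>_ _. True", OF this] show ?thesis by blast
  qed
  have col_minus: "col (A - B) j = A *\<^sub>v unit_vec q j - B *\<^sub>v unit_vec q j"
    if "A \<in> carrier_mat p q" "B \<in> carrier_mat p q" "j < q"
    for A B :: "('a, 'b) mpol mat" and p q j
    using that by (intro eq_vecI) auto
  show ?thesis
  proof (induction i)
    case 0
    have "augmented_cycle F e 0 (col (\<Theta> 0 - 1\<^sub>m (rnk F 0)) j)" if j: "j < rnk F 0" for j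
    proof -
      let ?u = "unit_vec (rnk F 0) j :: ('a, 'b) mpol vec"
      have "col (\<Theta> 0 - 1\<^sub>m (rnk F 0)) j = \<Theta> 0 *\<^sub>v ?u - ?u"
        using col_minus[OF c one_carrier_mat j] by simp
      then have "e \<bullet> col (\<Theta> 0 - 1\<^sub>m (rnk F 0)) j = e \<bullet> (\<Theta> 0 *\<^sub>v ?u) - e \<bullet> ?u"
        using scalar_prod_minus_distrib[OF ec mult_mat_vec_carrier[OF c] unit_vec_carrier] by simp
      then show ?thesis using \<Theta> by (simp add: augmented_cycle_def chain_map_def)
    qed
    from lift[OF minus_carrier_mat[OF one_carrier_mat] this] obtain h
      where h: "h \<in> carrier_mat (rnk F (Suc 0)) (rnk F 0)" "dif F 0 * h = \<Theta> 0 - 1\<^sub>m (rnk F 0)"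
      by blast
    have "\<Theta> 0 *\<^sub>v v - v = dif F 0 *\<^sub>v (h *\<^sub>v v)" if v: "v \<in> carrier_vec (rnk F 0)" for v
      using assoc_mult_mat_vec[OF d h(1) v] minus_mult_distrib_mat_vec[OF c one_carrier_mat v] v
      by (simp add: h(2))
    with h(1) show ?case by blast
  next
    case (Suc i)
    then obtain h where h: "h \<in> carrier_mat (rnk F (Suc i)) (rnk F i)"
      "\<And>v. v \<in> carrier_vec (rnk F i) \<Longrightarrow> augmented_cycle F e i v \<Longrightarrow>
        \<Theta> i *\<^sub>v v - v = dif F i *\<^sub>v (h *\<^sub>v v)" by blast
    let ?n = "rnk F (Suc i)"
    \<comment> \<open>What remains of the difference to the identity after the term with the
      previous \<open>h\<close>. Its values are cycles, because \<open>h\<close> is a homotopy on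
      the boundaries \<open>dif F i *\<^sub>v v\<close>; so it factors through the next
      differential.\<close>
    define N where "N = \<Theta> (Suc i) - 1\<^sub>m ?n - h * dif F i"
    have hd: "h * dif F i \<in> carrier_mat ?n ?n" using h(1) d by simp
    have Nc: "N \<in> carrier_mat ?n ?n" unfolding N_def by (rule minus_carrier_mat[OF hd])
    have \<Theta>1: "\<Theta> (Suc i) - 1\<^sub>m ?n \<in> carrier_mat ?n ?n"
      by (rule minus_carrier_mat[OF one_carrier_mat])
    have Nv: "N *\<^sub>v v = \<Theta> (Suc i) *\<^sub>v v - v - h *\<^sub>v (dif F i *\<^sub>v v)" if v: "v \<in> carrier_vec ?n" for v
      unfolding N_def minus_mult_distrib_mat_vec[OF \<Theta>1 hd v]
        minus_mult_distrib_mat_vec[OF c one_carrier_mat v] assoc_mult_mat_vec[OF h(1) d v]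
      using v by simp
    have "augmented_cycle F e (Suc i) (N *\<^sub>v v)" if v: "v \<in> carrier_vec ?n" for v
    proof -
      have dv: "dif F i *\<^sub>v v \<in> carrier_vec (rnk F i)" by (rule mult_mat_vec_carrier[OF d v])
      have tv: "\<Theta> (Suc i) *\<^sub>v v \<in> carrier_vec ?n" by (rule mult_mat_vec_carrier[OF c v])
      have hv: "h *\<^sub>v (dif F i *\<^sub>v v) \<in> carrier_vec ?n" by (rule mult_mat_vec_carrier[OF h(1) dv])
      have "dif F i *\<^sub>v (N *\<^sub>v v) =
          dif F i *\<^sub>v (\<Theta> (Suc i) *\<^sub>v v) - dif F i *\<^sub>v v - dif F i *\<^sub>v (h *\<^sub>v (dif F i *\<^sub>v v))"
        using mult_minus_distrib_mat_vec[OF d minus_carrier_vec[OF tv v] hv]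
          mult_minus_distrib_mat_vec[OF d tv v] by (simp add: Nv[OF v])
      also have "dif F i *\<^sub>v (\<Theta> (Suc i) *\<^sub>v v) = \<Theta> i *\<^sub>v (dif F i *\<^sub>v v)"
        using assoc_mult_mat_vec[OF d c v] assoc_mult_mat_vec[OF c d v] \<Theta>
        by (simp add: chain_map_def)
      also have "\<Theta> i *\<^sub>v (dif F i *\<^sub>v v) - dif F i *\<^sub>v v - dif F i *\<^sub>v (h *\<^sub>v (dif F i *\<^sub>v v)) = 0\<^sub>v (rnk F i)"
        using h(2)[OF dv augmented_cycle_dif[OF F v]] mult_mat_vec_carrier[OF d hv]
        by (simp only: minus_cancel_vec)
      finally show ?thesis by (simp add: augmented_cycle_def)
    qed
    then have "augmented_cycle F e (Suc i) (col N j)" if "j < ?n" for j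
      using mult_unit_vec[OF Nc that] unit_vec_carrier by metis
    from lift[OF Nc this] obtain h' where h':
      "h' \<in> carrier_mat (rnk F (Suc (Suc i))) ?n" "dif F (Suc i) * h' = N" by blast
    have "\<Theta> (Suc i) *\<^sub>v v - v = dif F (Suc i) *\<^sub>v (h' *\<^sub>v v)"
      if v: "v \<in> carrier_vec ?n" and cyc: "augmented_cycle F e (Suc i) v" for v
    proof -
      have "dif F (Suc i) *\<^sub>v (h' *\<^sub>v v) = N *\<^sub>v v" using assoc_mult_mat_vec[OF d h'(1) v] h'(2) by simp
      also have "\<dots> = \<Theta> (Suc i) *\<^sub>v v - v - h *\<^sub>v 0\<^sub>v (rnk F i)"
        using Nv[OF v] cyc by (simp add: augmented_cycle_def)
      also have "h *\<^sub>v 0\<^sub>v (rnk F i) = 0\<^sub>v ?n" using h(1) by auto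
      finally show ?thesis using mult_mat_vec_carrier[OF c v] v by simp
    qed
    with h'(1) show ?case by blast
  qed
qed

text \<open>An ideal absorbs multiplication by matrix entries, so comparison maps act on vectors
  over J, and so does the homotopy, which carries no grading.\<close>

lemma mult_mat_tensor_chains:
  assumes J: "mult_module.subspace J" and M: "M \<in> carrier_mat (rnk G k) (rnk F i)"
    and v: "v \<in> tensor_chains F J i"
  shows "M *\<^sub>v v \<in> tensor_chains G J k"
proof -
  have vc: "v \<in> carrier_vec (rnk F i)" using v by (simp add: tensor_chains_def)
  have "(M *\<^sub>v v) $ r \<in> J" if "r < rnk G k" for r
    unfolding mult_mat_vec_index_sum[OF M vc that]
    using v by (intro mult_module.subspace_sum[OF J] mult_module.subspace_scale[OF J])
      (auto simp: tensor_chains_def)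
  then show ?thesis using mult_mat_vec_carrier[OF M vc] by (simp add: tensor_chains_def)
qed

lemma tensor_chains_diff:
  assumes "mult_module.subspace J" "x \<in> tensor_chains F J i" "y \<in> tensor_chains F J i"
  shows "x - y \<in> tensor_chains F J i"
  using assms mult_module.subspace_diff[OF assms(1)] by (auto simp: tensor_chains_def)

lemma minus_vec_eq_swap:
  assumes "x \<in> carrier_vec q" "v \<in> carrier_vec q" "x - v = y"
  shows "v = x - (y :: 'a :: ab_group_add vec)"
  using assms by (intro eq_vecI) auto

text \<open>Since \<open>\<Psi>\<close> after \<open>\<Phi>\<close> is homotopic to the identity,
  \<open>\<Phi>\<close> is injective on homology. The index is a successor because in degree 0 every
  vector over J is a cycle, whereas the homotopy asks for a condition on the augmentation.\<close>

lemma Tor_transfer: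
  assumes F: "free_resolution_K F e" and G: "free_resolution_K G e'"
    and J: "mult_module.subspace J"
    and v: "v \<in> tensor_cycles F J (Suc l)" "homog_vec F (Suc l) a v"
      "v \<notin> tensor_boundaries F J (Suc l)"
  shows "\<exists>v'\<in>tensor_cycles G J (Suc l). homog_vec G (Suc l) a v' \<and> v' \<notin> tensor_boundaries G J (Suc l)"
proof -
  let ?i = "Suc l"
  obtain \<Phi> where \<Phi>: "chain_map F e G e' \<Phi>" using exists_chain_map[OF F G] by blast
  obtain \<Psi> where \<Psi>: "chain_map G e' F e \<Psi>" using exists_chain_map[OF G F] by blast
  have g: "graded_mat F i G i (\<Phi> i)" "graded_mat G i F i (\<Psi> i)" for i
    using \<Phi> \<Psi> by (auto simp: chain_map_def)
  note c = graded_matD(1)[OF g(1)] graded_matD(1)[OF g(2)]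
  note d = resolution_carrier(1)[OF F] resolution_carrier(1)[OF G]
  obtain h where h: "h \<in> carrier_mat (rnk F (Suc ?i)) (rnk F ?i)"
    "\<And>v. v \<in> carrier_vec (rnk F ?i) \<Longrightarrow> augmented_cycle F e ?i v \<Longrightarrow>
      (\<Psi> ?i * \<Phi> ?i) *\<^sub>v v - v = dif F ?i *\<^sub>v (h *\<^sub>v v)"
    using chain_map_homotopy[OF F chain_map_comp[OF F G F \<Phi> \<Psi>]] by blast
  have vJ: "v \<in> tensor_chains F J ?i" and dv: "dif F l *\<^sub>v v = 0\<^sub>v (rnk F l)"
    using v(1) by (auto simp: tensor_cycles_def)
  have vc: "v \<in> carrier_vec (rnk F ?i)" using vJ by (simp add: tensor_chains_def)
  define v' where "v' = \<Phi> ?i *\<^sub>v v"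
  have "dif G l *\<^sub>v v' = (dif G l * \<Phi> ?i) *\<^sub>v v" using assoc_mult_mat_vec[OF d(2) c(1) vc] by (simp add: v'_def)
  also have "\<dots> = \<Phi> l *\<^sub>v (dif F l *\<^sub>v v)"
    using assoc_mult_mat_vec[OF c(1) d(1) vc] \<Phi> by (simp add: chain_map_def)
  also have "\<dots> = 0\<^sub>v (rnk G l)" using c(1)[of l] dv by auto
  finally have "v' \<in> tensor_cycles G J ?i"
    using mult_mat_tensor_chains[OF J c(1) vJ] by (simp add: tensor_cycles_def v'_def)
  moreover have "homog_vec G ?i a v'" unfolding v'_def by (rule homog_vec_mult_mat[OF g(1) v(2)])
  moreover have "v' \<notin> tensor_boundaries G J ?i"
  proof
    assume "v' \<in> tensor_boundaries G J ?i"
    then obtain w where w: "w \<in> tensor_chains G J (Suc ?i)" "v' = dif G ?i *\<^sub>v w"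
      by (auto simp: tensor_boundaries_def)
    have wc: "w \<in> carrier_vec (rnk G (Suc ?i))" using w(1) by (simp add: tensor_chains_def)
    define x where "x = \<Psi> (Suc ?i) *\<^sub>v w"
    have xJ: "x \<in> tensor_chains F J (Suc ?i)" unfolding x_def by (rule mult_mat_tensor_chains[OF J c(2) w(1)])
    have hJ: "h *\<^sub>v v \<in> tensor_chains F J (Suc ?i)" by (rule mult_mat_tensor_chains[OF J h(1) vJ])
    have xc: "x \<in> carrier_vec (rnk F (Suc ?i))" "h *\<^sub>v v \<in> carrier_vec (rnk F (Suc ?i))"
      using xJ hJ by (simp_all add: tensor_chains_def)
    have "(\<Psi> ?i * \<Phi> ?i) *\<^sub>v v = \<Psi> ?i *\<^sub>v (dif G ?i *\<^sub>v w)"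
      using assoc_mult_mat_vec[OF c(2) c(1) vc] w(2) by (simp add: v'_def)
    also have "\<dots> = (\<Psi> ?i * dif G ?i) *\<^sub>v w" using assoc_mult_mat_vec[OF c(2) d(2) wc] by simp
    also have "\<dots> = (dif F ?i * \<Psi> (Suc ?i)) *\<^sub>v w" using \<Psi> by (simp add: chain_map_def)
    also have "\<dots> = dif F ?i *\<^sub>v x" using assoc_mult_mat_vec[OF d(1) c(2) wc] by (simp add: x_def)
    finally have px: "(\<Psi> ?i * \<Phi> ?i) *\<^sub>v v = dif F ?i *\<^sub>v x" .
    have "dif F ?i *\<^sub>v x - v = dif F ?i *\<^sub>v (h *\<^sub>v v)"
      using h(2)[OF vc] dv px by (simp add: augmented_cycle_def)
    then have "v = dif F ?i *\<^sub>v x - dif F ?i *\<^sub>v (h *\<^sub>v v)"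
      by (rule minus_vec_eq_swap[OF mult_mat_vec_carrier[OF d(1) xc(1)] vc])
    also have "\<dots> = dif F ?i *\<^sub>v (x - h *\<^sub>v v)"
      by (rule mult_minus_distrib_mat_vec[symmetric, OF d(1) xc])
    finally have "v = dif F ?i *\<^sub>v (x - h *\<^sub>v v)" .
    moreover have "x - h *\<^sub>v v \<in> tensor_chains F J (Suc ?i)"
      by (rule tensor_chains_diff[OF J xJ hJ])
    ultimately show False using v(3) by (auto simp: tensor_boundaries_def)
  qed
  ultimately show ?thesis by blast
qed


section \<open>The Koszul complex on the variables\<close>

lemma xpow_mult_eq_0_iff: "xpow a * f = 0 \<longleftrightarrow> f = (0 :: ('n, 'k::field) mpol)"
  using keys_xpow_mult[of a f] by (metis image_is_empty keys_eq_empty)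

lemma var_mult_cancel: "var j * f = var j * g \<longleftrightarrow> f = (g :: ('n, 'k::field) mpol)"
proof -
  have "var j * (f - g) = 0 \<longleftrightarrow> f - g = 0" unfolding var_def by (rule xpow_mult_eq_0_iff)
  then show ?thesis by (simp add: right_diff_distrib)
qed

lemma exists_var_quotient:
  fixes f :: "('n, 'k::field) mpol"
  assumes "\<And>m. m \<in> keys f \<Longrightarrow> lookup m j \<noteq> 0"
  shows "\<exists>g. var j * g = f"
proof -
  let ?e = "Poly_Mapping.single j 1"
  \<comment> \<open>The difference of exponents is not truncated, because the j-th entry of
    \<open>m\<close> is positive.\<close>
  have "var j * Poly_Mapping.single (m - ?e) c = Poly_Mapping.single m c"
    if "m \<in> keys f" for m and c :: 'k
  proof -
    have "m = ?e + (m - ?e)"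
      using assms[OF that] by (intro poly_mapping_eqI) (auto simp: lookup_add lookup_minus lookup_single when_def)
    then show ?thesis by (simp add: var_def xpow_def mult_single)
  qed
  then have "var j * (\<Sum>m\<in>keys f. Poly_Mapping.single (m - ?e) (lookup f m)) = f"
    by (simp add: sum_distrib_left mpol_sum_single)
  then show ?thesis ..
qed

section \<open>Basis, signs and differential of the Koszul complex\<close>

definition ksets :: "nat \<Rightarrow> 'n::finite set set"
  where "ksets i = {\<sigma>. card \<sigma> = i}"

text \<open>\<open>gr_complex\<close> numbers its basis vectors, whereas the Koszul complex has a
  basis of subsets; any enumeration will do.\<close>

definition kenum :: "nat \<Rightarrow> nat \<Rightarrow> 'n::finite set"
  where "kenum i = (SOME h. bij_betw h {..<card (ksets i :: 'n set set)} (ksets i))"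

lemma finite_ksets [simp]: "finite (ksets i :: 'n::finite set set)"
  by simp

lemma kenum_bij: "bij_betw (kenum i) {..<card (ksets i :: 'n::finite set set)} (ksets i :: 'n set set)"
proof -
  have "\<exists>h. bij_betw h {..<card (ksets i :: 'n set set)} (ksets i :: 'n set set)"
    using ex_bij_betw_nat_finite[OF finite_ksets] by (simp add: atLeast0LessThan)
  then show ?thesis unfolding kenum_def by (rule someI_ex)
qed

lemma kenum_in: "r < card (ksets i :: 'n::finite set set) \<Longrightarrow> kenum i r \<in> (ksets i :: 'n set set)"
  using bij_betw_apply[OF kenum_bij] by blast

lemma kenum_obtain:
  assumes "\<sigma> \<in> (ksets i :: 'n::finite set set)"
  obtains r where "r < card (ksets i :: 'n set set)" "kenum i r = \<sigma>"
proof -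
  have "\<sigma> \<in> kenum i ` {..<card (ksets i :: 'n set set)}"
    using assms by (simp only: bij_betw_imp_surj_on[OF kenum_bij])
  then show ?thesis using that by blast
qed

text \<open>The type of variables carries no order; an arbitrary injection supplies the one behind
  the signs.\<close>

definition pos :: "'n::finite \<Rightarrow> nat"
  where "pos = (SOME h. inj h)"

lemma inj_pos: "inj (pos :: 'n::finite \<Rightarrow> nat)"
proof -
  have "\<exists>h :: 'n \<Rightarrow> nat. inj h" using finite_imp_inj_to_nat_seg[of "UNIV :: 'n set"] by auto
  then show ?thesis unfolding pos_def by (rule someI_ex)
qed

text \<open>The sign of sorting the wedge product of e_j with e_\<sigma>.\<close>

definition ksign :: "'n::finite \<Rightarrow> 'n set \<Rightarrow> ('n, 'k::field) mpol"
  where "ksign j \<sigma> = (-1) ^ card {i \<in> \<sigma>. pos i < pos j}"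

lemma ksign_cases: "ksign j \<sigma> = (1 :: ('n::finite, 'k::field) mpol) \<or> ksign j \<sigma> = (-1 :: ('n, 'k) mpol)"
  by (simp add: ksign_def minus_one_power_iff)

lemma ksign_sq [simp]: "ksign j \<sigma> * ksign j \<sigma> = (1 :: ('n::finite, 'k::field) mpol)"
  using ksign_cases[of j \<sigma>, where 'k = 'k] by auto

lemma ksign_sq' [simp]: "ksign j \<sigma> * (ksign j \<sigma> * f) = f"
  by (simp flip: mult.assoc)

lemma ksign_insert:
  assumes "k \<notin> \<sigma>"
  shows "ksign j (insert k \<sigma>) = (if pos k < pos j then - ksign j \<sigma> else ksign j \<sigma>)"
proof -
  have "{i \<in> insert k \<sigma>. pos i < pos j} =
      (if pos k < pos j then insert k {i \<in> \<sigma>. pos i < pos j} else {i \<in> \<sigma>. pos i < pos j})" by auto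
  then show ?thesis using assms by (simp add: ksign_def)
qed

text \<open>Exactly one of \<open>j\<close> and \<open>k\<close> precedes the other, so exactly one
  of the two insertions flips a sign.\<close>

lemma ksign_swap:
  assumes "j \<noteq> k" "j \<notin> \<sigma>" "k \<notin> \<sigma>"
  shows "ksign j \<sigma> * ksign k (insert j \<sigma>) = - (ksign k \<sigma> * ksign j (insert k \<sigma>))"
proof -
  have "pos j \<noteq> pos k" using assms(1) inj_pos by (metis injD)
  then show ?thesis using assms by (auto simp: ksign_insert mult.commute)
qed

text \<open>The multidegree of the basis vector e_\<sigma>; for \<open>UNIV\<close> it is the
  exponent of x_1...x_n.\<close>

definition indic :: "'n::finite set \<Rightarrow> 'n expo"
  where "indic \<sigma> = (\<Sum>j\<in>\<sigma>. Poly_Mapping.single j 1)"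

lemma indic_insert: "j \<notin> \<sigma> \<Longrightarrow> indic (insert j \<sigma>) = Poly_Mapping.single j 1 + indic \<sigma>"
  by (simp add: indic_def)

lemma lookup_indic: "lookup (indic \<sigma>) j = (if j \<in> \<sigma> then 1 else 0)"
  by (simp add: indic_def lookup_sum lookup_single when_def)

text \<open>At most one \<open>j\<close> contributes, the element of
  \<open>\<tau> - \<sigma>\<close>; the sum avoids choosing it and can be swapped with the one over
  \<open>\<tau>\<close> in \<open>dif_kvec\<close>.\<close>

definition kentry :: "'n::finite set \<Rightarrow> 'n set \<Rightarrow> ('n, 'k::field) mpol"
  where "kentry \<sigma> \<tau> = (\<Sum>j\<in>-\<sigma>. if insert j \<sigma> = \<tau> then ksign j \<sigma> * var j else 0)"

definition koszul :: "('n::finite, 'k::field) gr_complex"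
  where "koszul = \<lparr>
    rnk = (\<lambda>i. card (ksets i :: 'n set set)),
    shift = (\<lambda>i j. indic (kenum i j)),
    dif = (\<lambda>i. mat (card (ksets i :: 'n set set)) (card (ksets (Suc i) :: 'n set set))
      (\<lambda>(r, c). kentry (kenum i r) (kenum (Suc i) c)))\<rparr>"

lemma koszul_simps [simp]:
  "rnk (koszul :: ('n::finite, 'k::field) gr_complex) i = card (ksets i :: 'n set set)"
  "shift koszul i j = indic (kenum i j)"
  by (simp_all add: koszul_def)

lemma dif_koszul_carrier:
  "dif (koszul :: ('n::finite, 'k::field) gr_complex) i \<in>
    carrier_mat (card (ksets i :: 'n set set)) (card (ksets (Suc i) :: 'n set set))"
  by (simp add: koszul_def)

definition kvec :: "nat \<Rightarrow> ('n::finite set \<Rightarrow> ('n, 'k::field) mpol) \<Rightarrow> ('n, 'k) mpol vec"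
  where "kvec i w = vec (card (ksets i :: 'n set set)) (\<lambda>r. w (kenum i r))"

text \<open>Computing with functions on subsets keeps the enumeration out of the algebra;
  \<open>dif_kvec\<close> links it to the matrices.\<close>

definition kd :: "('n::finite set \<Rightarrow> ('n, 'k::field) mpol) \<Rightarrow> 'n set \<Rightarrow> ('n, 'k) mpol"
  where "kd w \<sigma> = (\<Sum>j\<in>-\<sigma>. ksign j \<sigma> * (var j * w (insert j \<sigma>)))"

lemma kvec_carrier [simp]: "kvec i (w :: 'n::finite set \<Rightarrow> _) \<in> carrier_vec (card (ksets i :: 'n set set))"
  by (simp add: kvec_def)

lemma kvec_index [simp]: "r < card (ksets i :: 'n::finite set set) \<Longrightarrow> kvec i w $ r = w (kenum i r :: 'n set)"
  by (simp add: kvec_def)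

lemma kvec_eq_iff: "kvec i w = kvec i w' \<longleftrightarrow> (\<forall>\<sigma>\<in>ksets i. w \<sigma> = w' \<sigma>)"
proof
  assume e: "kvec i w = kvec i w'"
  show "\<forall>\<sigma>\<in>ksets i. w \<sigma> = w' \<sigma>"
  proof
    fix \<sigma> :: "'a set" assume "\<sigma> \<in> ksets i"
    then obtain r where "r < card (ksets i :: 'a set set)" "kenum i r = \<sigma>" by (rule kenum_obtain)
    then show "w \<sigma> = w' \<sigma>" using kvec_index[of r i w] kvec_index[of r i w'] e by simp
  qed
qed (auto simp: kvec_def kenum_in intro!: eq_vecI)

lemma exists_kvec:
  assumes "v \<in> carrier_vec (card (ksets i :: 'n::finite set set))"
  shows "\<exists>w :: 'n set \<Rightarrow> ('n, 'k::field) mpol. v = kvec i w"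
proof -
  let ?D = "{..<card (ksets i :: 'n set set)}"
  have "v = kvec i (\<lambda>\<sigma>. v $ the_inv_into ?D (kenum i) (\<sigma> :: 'n set))"
    using assms the_inv_into_f_f[OF bij_betw_imp_inj_on[OF kenum_bij[of i, where 'n = 'n]]]
    by (intro eq_vecI) (auto simp: kvec_def)
  then show ?thesis by blast
qed

lemma kvec_zero: "0\<^sub>v (card (ksets i :: 'n::finite set set)) = kvec i (\<lambda>_ :: 'n set. 0)"
  by (intro eq_vecI) (auto simp: kvec_def)

lemma insert_ksets: "\<sigma> \<in> ksets i \<Longrightarrow> j \<notin> \<sigma> \<Longrightarrow> insert j \<sigma> \<in> ksets (Suc i)"
  by (simp add: ksets_def)

lemma dif_kvec: "dif koszul i *\<^sub>v kvec (Suc i) w = kvec i (kd w)"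
proof (rule eq_vecI)
  fix r assume "r < dim_vec (kvec i (kd w))"
  then have r: "r < card (ksets i :: 'a set set)" by (simp add: kvec_def)
  let ?\<sigma> = "kenum i r :: 'a set"
  let ?N = "card (ksets (Suc i) :: 'a set set)"
  have "(dif koszul i *\<^sub>v kvec (Suc i) w) $ r =
      (\<Sum>c<?N. kentry ?\<sigma> (kenum (Suc i) c) * w (kenum (Suc i) c))"
    unfolding mult_mat_vec_index_sum[OF dif_koszul_carrier kvec_carrier r]
    using r by (intro sum.cong) (simp_all add: koszul_def)
  also have "\<dots> = (\<Sum>\<tau>\<in>ksets (Suc i). kentry ?\<sigma> \<tau> * w \<tau>)"
    by (rule sum.reindex_bij_betw[OF kenum_bij])
  also have "\<dots> = (\<Sum>\<tau>\<in>ksets (Suc i). \<Sum>j\<in>-?\<sigma>. if insert j ?\<sigma> = \<tau> then ksign j ?\<sigma> * (var j * w \<tau>) else 0)"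
    unfolding kentry_def sum_distrib_right by (intro sum.cong refl) (simp add: mult.assoc)
  also have "\<dots> = (\<Sum>j\<in>-?\<sigma>. \<Sum>\<tau>\<in>ksets (Suc i). if insert j ?\<sigma> = \<tau> then ksign j ?\<sigma> * (var j * w \<tau>) else 0)"
    by (rule sum.swap)
  also have "\<dots> = kd w ?\<sigma>"
    unfolding kd_def using insert_ksets[OF kenum_in[OF r]] by (intro sum.cong refl) (simp add: sum.delta')
  finally show "(dif koszul i *\<^sub>v kvec (Suc i) w) $ r = kvec i (kd w) $ r" using r by simp
qed (use dif_koszul_carrier in \<open>auto simp: kvec_def\<close>)

section \<open>The Koszul differential is graded and squares to zero\<close>

text \<open>Swapping the indices shows only that the sum equals its negative, which is not enough in
  characteristic 2; in the induction the new terms cancel in pairs.\<close>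

lemma sum_antisymmetric_pairs:
  fixes f :: "'a \<Rightarrow> 'a \<Rightarrow> 'b::ab_group_add"
  assumes "finite A" "\<And>j k. j \<in> A \<Longrightarrow> k \<in> A \<Longrightarrow> j \<noteq> k \<Longrightarrow> f j k = - f k j"
  shows "(\<Sum>j\<in>A. \<Sum>k\<in>A - {j}. f j k) = 0"
  using assms
proof (induction A rule: finite_induct)
  case (insert a A)
  have "(\<Sum>k\<in>insert a A - {j}. f j k) = f j a + (\<Sum>k\<in>A - {j}. f j k)" if "j \<in> A" for j
  proof -
    have "insert a A - {j} = insert a (A - {j})" using that insert.hyps by auto
    then show ?thesis using insert.hyps by simp
  qed
  moreover have "(\<Sum>j\<in>A. f j a) = - (\<Sum>k\<in>A. f a k)"
    unfolding sum_negf[symmetric] using insert.prems insert.hyps by (intro sum.cong refl) auto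
  moreover have "(\<Sum>j\<in>A. \<Sum>k\<in>A - {j}. f j k) = 0" using insert.IH insert.prems by blast
  moreover have "insert a A - {a} = A" using insert.hyps by auto
  ultimately show ?case using insert.hyps by (simp add: sum.distrib)
qed simp

lemma kd_kd: "kd (kd w) \<sigma> = 0"
proof -
  define f where "f j k = ksign j \<sigma> * (var j * (ksign k (insert j \<sigma>) * (var k * w (insert k (insert j \<sigma>)))))"
    for j k
  have "- insert j \<sigma> = - \<sigma> - {j}" for j by auto
  then have "kd (kd w) \<sigma> = (\<Sum>j\<in>-\<sigma>. \<Sum>k\<in>-\<sigma> - {j}. f j k)"
    by (simp add: kd_def f_def sum_distrib_left)
  also have "\<dots> = 0"
  proof (rule sum_antisymmetric_pairs)
    fix j k assume "j \<in> - \<sigma>" "k \<in> - \<sigma>" "j \<noteq> k"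
    then have s: "ksign j \<sigma> * ksign k (insert j \<sigma>) = - (ksign k \<sigma> * ksign j (insert k \<sigma>))"
      using ksign_swap[of j k \<sigma>] by blast
    let ?w = "w (insert k (insert j \<sigma>))"
    have "f j k = (ksign j \<sigma> * ksign k (insert j \<sigma>)) * (var j * (var k * ?w))"
      by (simp add: f_def ac_simps)
    also have "\<dots> = - ((ksign k \<sigma> * ksign j (insert k \<sigma>)) * (var j * (var k * ?w)))"
      unfolding s by simp
    also have "\<dots> = - f k j" by (simp add: f_def ac_simps insert_commute)
    finally show "f j k = - f k j" .
  qed simp
  finally show ?thesis .
qed

lemma keys_ksign_mult: "keys (ksign j \<sigma> * f) = keys (f :: ('n::finite, 'k::field) mpol)"
  using ksign_cases[of j \<sigma>, where 'k = 'k] by (auto simp: in_keys_iff)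

lemma graded_dif_koszul:
  "graded_mat koszul (Suc i) koszul i (dif (koszul :: ('n::finite, 'k::field) gr_complex) i)"
  unfolding graded_mat_def homog_vec_def
proof (intro conjI allI impI ballI)
  show "dif (koszul :: ('n, 'k) gr_complex) i \<in> carrier_mat (rnk (koszul :: ('n, 'k) gr_complex) i) (rnk (koszul :: ('n, 'k) gr_complex) (Suc i))"
    using dif_koszul_carrier by simp
  then show "col (dif (koszul :: ('n, 'k) gr_complex) i) c \<in> carrier_vec (rnk (koszul :: ('n, 'k) gr_complex) i)"
    if "c < rnk (koszul :: ('n, 'k) gr_complex) (Suc i)" for c
    using that by simp
  fix c r and m :: "'n expo"
  assume c: "c < rnk (koszul :: ('n, 'k) gr_complex) (Suc i)"
    and r: "r < rnk (koszul :: ('n, 'k) gr_complex) i"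
    and m: "m \<in> keys (col (dif (koszul :: ('n, 'k) gr_complex) i) c $ r)"
  let ?\<sigma> = "kenum i r :: 'n set" and ?\<tau> = "kenum (Suc i) c :: 'n set"
  have "col (dif (koszul :: ('n, 'k) gr_complex) i) c $ r = kentry ?\<sigma> ?\<tau>"
    using c r by (simp add: koszul_def)
  with m have "m \<in> keys (kentry ?\<sigma> ?\<tau> :: ('n, 'k) mpol)" by simp
  then obtain j where j: "j \<notin> ?\<sigma>"
      "m \<in> keys (if insert j ?\<sigma> = ?\<tau> then ksign j ?\<sigma> * var j else (0 :: ('n, 'k) mpol))"
    unfolding kentry_def using Poly_Mapping.keys_sum by fastforce
  then have "insert j ?\<sigma> = ?\<tau>" "m = Poly_Mapping.single j 1"
    by (auto simp: keys_ksign_mult split: if_splits)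
  then show "m + shift (koszul :: ('n, 'k) gr_complex) i r = shift (koszul :: ('n, 'k) gr_complex) (Suc i) c"
    using indic_insert[OF j(1)] by simp
qed

section \<open>Exactness of the Koszul complex\<close>

text \<open>Only the finitely many multidegrees in \<open>D\<close> occur in \<open>v\<close>, so
  preimages of its components can be added up.\<close>

lemma exists_preimage_of_homogeneous:
  fixes M :: "('n, 'k::field) mpol mat"
  assumes M: "graded_mat H l G k M" and v: "v \<in> carrier_vec (rnk G k)"
    and pre: "\<And>a. \<exists>w\<in>carrier_vec (rnk H l). M *\<^sub>v w = hpart G k a v"
  shows "\<exists>w\<in>carrier_vec (rnk H l). M *\<^sub>v w = v"
proof -
  note Mc = graded_matD(1)[OF M]
  obtain w where w: "\<And>a. w a \<in> carrier_vec (rnk H l)" "\<And>a. M *\<^sub>v w a = hpart G k a v"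
    using pre by metis
  define D where "D = (\<Union>r<rnk G k. (\<lambda>m. m + shift G k r) ` keys (v $ r))"
  have fin: "finite D" by (simp add: D_def)
  define u where "u = vec (rnk H l) (\<lambda>j. \<Sum>a\<in>D. w a $ j)"
  have uc: "u \<in> carrier_vec (rnk H l)" by (simp add: u_def)
  have "(M *\<^sub>v u) $ r = v $ r" if r: "r < rnk G k" for r
  proof -
    have "(M *\<^sub>v u) $ r = (\<Sum>j<rnk H l. \<Sum>a\<in>D. M $$ (r, j) * w a $ j)"
      unfolding mult_mat_vec_index_sum[OF Mc uc r] by (simp add: u_def sum_distrib_left)
    also have "\<dots> = (\<Sum>a\<in>D. \<Sum>j<rnk H l. M $$ (r, j) * w a $ j)" by (rule sum.swap)
    also have "\<dots> = (\<Sum>a\<in>D. hpart G k a v $ r)"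
      using mult_mat_vec_index_sum[OF Mc w(1) r] w(2) by simp
    also have "\<dots> = v $ r"
    proof (rule poly_mapping_eqI)
      fix m
      have "lookup (\<Sum>a\<in>D. hpart G k a v $ r) m =
          (\<Sum>a\<in>D. if a = m + shift G k r then lookup (v $ r) m else 0)"
        using r by (auto simp: lookup_sum hpart_def lookup_mpart when_def intro!: sum.cong)
      also have "\<dots> = (if m + shift G k r \<in> D then lookup (v $ r) m else 0)"
        using fin by (simp add: sum.delta')
      also have "\<dots> = lookup (v $ r) m"
      proof (cases "m \<in> keys (v $ r)")
        case True
        then have "m + shift G k r \<in> D" using r unfolding D_def by blast
        then show ?thesis by simp
      qed (simp add: in_keys_iff)
      finally show "lookup (\<Sum>a\<in>D. hpart G k a v $ r) m = lookup (v $ r) m" .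
    qed
    finally show ?thesis .
  qed
  then have "M *\<^sub>v u = v" using v Mc by (intro eq_vecI) auto
  with uc show ?thesis by blast
qed

text \<open>
  In multidegree \<open>a\<close> with \<open>a j > 0\<close>, exterior multiplication by the \<open>j\<close>-th basis vector followed by
  division by the \<open>j\<close>-th variable is a contracting homotopy.
\<close>

lemma koszul_exact_homogeneous:
  fixes w :: "'n::finite set \<Rightarrow> ('n, 'k::field) mpol"
  assumes w: "\<And>\<sigma> m. \<sigma> \<in> ksets (Suc l) \<Longrightarrow> m \<in> keys (w \<sigma>) \<Longrightarrow> m + indic \<sigma> = a"
    and cyc: "\<And>\<sigma>. \<sigma> \<in> ksets l \<Longrightarrow> kd w \<sigma> = 0"
  shows "\<exists>u. \<forall>\<sigma>\<in>ksets (Suc l). kd u \<sigma> = w \<sigma>"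
\<comment> \<open>In positive exterior degree every basis vector has nonzero multidegree, so nothing
  lives in multidegree 0.\<close>
proof (cases "a = 0")
  case True
  have "w \<sigma> = 0" if s: "\<sigma> \<in> ksets (Suc l)" for \<sigma>
  proof (rule ccontr)
    assume "w \<sigma> \<noteq> 0"
    then have "keys (w \<sigma>) \<noteq> {}" by simp
    then obtain m where "m \<in> keys (w \<sigma>)" by blast
    with w[OF s] True have "m + indic \<sigma> = 0" by blast
    moreover have "\<sigma> \<noteq> {}" using s by (auto simp: ksets_def)
    then obtain j where "j \<in> \<sigma>" by blast
    then have "lookup (m + indic \<sigma>) j \<noteq> 0" by (simp add: lookup_add lookup_indic)
    ultimately show False by simp
  qed
  then show ?thesis by (intro exI[of _ "\<lambda>_. 0"]) (simp add: kd_def)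
next
  case False
  then obtain j where j: "lookup a j \<noteq> 0" by (metis lookup_zero poly_mapping_eqI)
  have "\<exists>g. var j * g = w \<sigma>" if "\<sigma> \<in> ksets (Suc l)" "j \<notin> \<sigma>" for \<sigma>
  proof (rule exists_var_quotient)
    fix m assume "m \<in> keys (w \<sigma>)"
    then have "m + indic \<sigma> = a" by (rule w[OF that(1)])
    then have "lookup (m + indic \<sigma>) j \<noteq> 0" using j by simp
    then show "lookup m j \<noteq> 0" using that(2) by (simp add: lookup_add lookup_indic)
  qed
  then obtain q where q: "\<And>\<sigma>. \<sigma> \<in> ksets (Suc l) \<Longrightarrow> j \<notin> \<sigma> \<Longrightarrow> var j * q \<sigma> = w \<sigma>" by metis
  define u where "u \<tau> = (if j \<in> \<tau> then ksign j (\<tau> - {j}) * q (\<tau> - {j}) else 0)" for \<tau>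
  have u: "var j * u \<tau> = (if j \<in> \<tau> then ksign j (\<tau> - {j}) * w (\<tau> - {j}) else 0)"
    if "\<tau> \<in> ksets (Suc (Suc l))" for \<tau>
    using q[of "\<tau> - {j}"] that by (auto simp: u_def ksets_def mult.left_commute[of "var j"])
  have "kd u \<sigma> = w \<sigma>" if s: "\<sigma> \<in> ksets (Suc l)" for \<sigma>
  proof -
    let ?S = "\<Sum>k\<in>-\<sigma>. ksign k \<sigma> * (var k *
        (if j \<in> insert k \<sigma> then ksign j (insert k \<sigma> - {j}) * w (insert k \<sigma> - {j}) else 0))"
    \<comment> \<open>The claim is proved after multiplication by x_j, which removes the quotients
      \<open>q\<close>; the factor is cancelled at the end.\<close>
    have "var j * kd u \<sigma> = (\<Sum>k\<in>-\<sigma>. ksign k \<sigma> * (var k * (var j * u (insert k \<sigma>))))"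
      by (simp add: kd_def sum_distrib_left ac_simps)
    also have "\<dots> = ?S"
      using u insert_ksets[OF s] by (intro sum.cong refl) auto
    also have "?S = var j * w \<sigma>"
    proof (cases "j \<in> \<sigma>")
      case False
      \<comment> \<open>Only k = j brings j into the set, and its sign occurs twice.\<close>
      then have "?S = (\<Sum>k\<in>-\<sigma>. if k = j then var j * w \<sigma> else 0)"
        by (intro sum.cong refl) (auto simp: mult.left_commute[of "var j"])
      also have "\<dots> = var j * w \<sigma>" using False by simp
      finally show ?thesis .
    next
      case True
      define \<tau> where "\<tau> = \<sigma> - {j}"
      have \<tau>: "\<sigma> = insert j \<tau>" "j \<notin> \<tau>" "\<tau> \<in> ksets l" using True s by (auto simp: \<tau>_def ksets_def)
      define R where "R = (\<Sum>k\<in>-\<sigma>. ksign k \<tau> * (var k * w (insert k \<tau>)))"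
      \<comment> \<open>The cycle condition at \<open>\<tau>\<close> consists of the term for j,
        which is the wanted one up to sign, and the rest \<open>R\<close>.\<close>
      have "- \<tau> = insert j (- \<sigma>)" using \<tau> by auto
      then have "kd w \<tau> = ksign j \<tau> * (var j * w \<sigma>) + R" using \<tau>(1,2) by (simp add: kd_def R_def)
      then have R: "R = - (ksign j \<tau> * (var j * w \<sigma>))" using cyc[OF \<tau>(3)] by (simp add: eq_neg_iff_add_eq_0 add.commute)
      have "ksign k \<sigma> * (var k *
          (if j \<in> insert k \<sigma> then ksign j (insert k \<sigma> - {j}) * w (insert k \<sigma> - {j}) else 0))
          = - ksign j \<tau> * (ksign k \<tau> * (var k * w (insert k \<tau>)))" if k: "k \<in> - \<sigma>" for k
      proof -
        have kj: "k \<noteq> j" "k \<notin> \<tau>" using k \<tau> by auto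
        have i: "insert k \<sigma> - {j} = insert k \<tau>" using \<tau> kj by auto
        have "ksign j \<tau> * ksign k \<sigma> = - (ksign k \<tau> * ksign j (insert k \<tau>) :: ('n, 'k) mpol)"
          using ksign_swap[of j k \<tau>] kj \<tau> by auto
        \<comment> \<open>Signs square to 1, so multiplying by the two outer ones solves
          \<open>ksign_swap\<close> for the product that occurs below.\<close>
        then have "ksign j \<tau> * (ksign j \<tau> * ksign k \<sigma>) * ksign j (insert k \<tau>) =
            ksign j \<tau> * (- (ksign k \<tau> * ksign j (insert k \<tau>) :: ('n, 'k) mpol)) * ksign j (insert k \<tau>)"
          by (rule arg_cong)
        then have "ksign k \<sigma> * ksign j (insert k \<tau>) = - (ksign j \<tau> * ksign k \<tau> :: ('n, 'k) mpol)"
          by (simp add: mult.assoc)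
        moreover have "ksign k \<sigma> * (var k * (ksign j (insert k \<tau>) * w (insert k \<tau>))) =
            (ksign k \<sigma> * ksign j (insert k \<tau>)) * (var k * w (insert k \<tau>))" by (simp add: ac_simps)
        ultimately show ?thesis using True by (simp add: i mult.assoc)
      qed
      then have "?S = - ksign j \<tau> * R"
        by (simp add: R_def sum_distrib_left)
      also have "\<dots> = var j * w \<sigma>" unfolding R by simp
      finally show ?thesis .
    qed
    finally show ?thesis by (simp add: var_mult_cancel)
  qed
  then show ?thesis by blast
qed

lemma ksets_0: "ksets 0 = {{} :: 'n::finite set}"
  by (auto simp: ksets_def)

lemma koszul_exact:
  assumes v: "v \<in> carrier_vec (card (ksets (Suc l) :: 'n::finite set set))"
    and cyc: "dif koszul l *\<^sub>v v = 0\<^sub>v (card (ksets l :: 'n set set))"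
  shows "\<exists>w\<in>carrier_vec (card (ksets (Suc (Suc l)) :: 'n set set)).
    dif (koszul :: ('n, 'k::field) gr_complex) (Suc l) *\<^sub>v w = v"
proof -
  let ?K = "koszul :: ('n, 'k) gr_complex"
  have vc: "v \<in> carrier_vec (rnk ?K (Suc l))" using v by simp
  have "\<exists>w\<in>carrier_vec (rnk ?K (Suc (Suc l))). dif ?K (Suc l) *\<^sub>v w = hpart ?K (Suc l) a v" for a
  proof -
    have "hpart ?K (Suc l) a v \<in> carrier_vec (card (ksets (Suc l) :: 'n set set))"
      using hpart_carrier[of ?K "Suc l" a v] by simp
    then obtain x :: "'n set \<Rightarrow> ('n, 'k) mpol" where x: "hpart ?K (Suc l) a v = kvec (Suc l) x"
      using exists_kvec by blast
    have "m + indic \<sigma> = a" if s: "\<sigma> \<in> ksets (Suc l)" and m: "m \<in> keys (x \<sigma>)" for \<sigma> m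
    proof -
      obtain r where r: "r < card (ksets (Suc l) :: 'n set set)" "kenum (Suc l) r = \<sigma>"
        using s by (rule kenum_obtain)
      have "homog_vec ?K (Suc l) a (kvec (Suc l) x)" using homog_vec_hpart x by metis
      then show ?thesis using r m by (auto simp: homog_vec_def)
    qed
    moreover have "kd x \<sigma> = 0" if "\<sigma> \<in> ksets l" for \<sigma>
    proof -
      have "kvec l (kd x) = hpart ?K l a (dif ?K l *\<^sub>v v)"
        using mult_mat_hpart[OF graded_dif_koszul vc] dif_kvec x by metis
      also have "\<dots> = kvec l (\<lambda>_. 0)"
        unfolding cyc kvec_zero[symmetric] by (rule hpart_eq) (simp add: homog_vec_def)
      finally show ?thesis using that by (simp add: kvec_eq_iff)
    qed
    ultimately obtain u where "\<forall>\<sigma>\<in>ksets (Suc l). kd u \<sigma> = x \<sigma>"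
      using koszul_exact_homogeneous[of l x a] by blast
    then have "dif ?K (Suc l) *\<^sub>v kvec (Suc (Suc l)) u = hpart ?K (Suc l) a v"
      unfolding dif_kvec x by (simp add: kvec_eq_iff)
    then show ?thesis using kvec_carrier by (intro bexI) auto
  qed
  from exists_preimage_of_homogeneous[OF graded_dif_koszul vc this] show ?thesis by simp
qed

text \<open>Such sums are the values at the empty set of the first Koszul differential, so this
  gives exactness at the augmentation.\<close>

lemma maxideal_sum:
  assumes "f \<in> (maxideal :: ('n::finite, 'k::field) mpol set)"
  shows "\<exists>w. f = (\<Sum>j\<in>UNIV. var j * w j)"
proof -
  let ?T = "{f :: ('n, 'k) mpol. \<exists>w. f = (\<Sum>j\<in>UNIV. var j * w j)}"
  have T: "f \<in> ?T" if "f = (\<Sum>j\<in>UNIV. var j * w j)" for f w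
    using that by blast
  have "maxideal \<subseteq> ?T" unfolding maxideal_def
  proof (rule mult_module.span_minimal)
    show "range var \<subseteq> ?T"
    proof
      fix f :: "('n, 'k) mpol" assume "f \<in> range var"
      then obtain i where i: "f = var i" by blast
      have "f = (\<Sum>j\<in>UNIV. var j * (if j = i then 1 else 0))"
        unfolding i by (simp add: if_distrib[of "(*) _"] cong: if_cong)
      then show "f \<in> ?T" by (rule T)
    qed
    show "mult_module.subspace ?T"
    proof (rule mult_module.subspaceI)
      have "(0 :: ('n, 'k) mpol) = (\<Sum>j\<in>UNIV. var j * 0)" by simp
      then show "0 \<in> ?T" by (rule T)
    next
      fix f g :: "('n, 'k) mpol" assume "f \<in> ?T" "g \<in> ?T"
      then obtain x y where "f = (\<Sum>j\<in>UNIV. var j * x j)" "g = (\<Sum>j\<in>UNIV. var j * y j)" by blast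
      then have "f + g = (\<Sum>j\<in>UNIV. var j * (x j + y j))" by (simp add: distrib_left sum.distrib)
      then show "f + g \<in> ?T" by (rule T)
    next
      fix c f :: "('n, 'k) mpol" assume "f \<in> ?T"
      then obtain x where "f = (\<Sum>j\<in>UNIV. var j * x j)" by blast
      then have "c * f = (\<Sum>j\<in>UNIV. var j * (c * x j))" by (simp add: sum_distrib_left mult.left_commute)
      then show "c * f \<in> ?T" by (rule T)
    qed
  qed
  with assms show ?thesis by blast
qed

lemma free_resolution_koszul:
  "free_resolution_K (koszul :: ('n::finite, 'k::field) gr_complex) (vec 1 (\<lambda>_. 1))"
proof -
  let ?K = "koszul :: ('n, 'k) gr_complex" and ?e = "vec 1 (\<lambda>_. 1) :: ('n, 'k) mpol vec"
  have r0: "rnk ?K 0 = 1" by (simp add: ksets_0)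
  have e0: "kenum 0 0 = ({} :: 'n set)" using kenum_in[of 0 0, where 'n = 'n] by (simp add: ksets_0)
  have ev: "?e \<bullet> v = v $ 0" if "v \<in> carrier_vec 1" for v
    using that by (simp add: scalar_prod_def)
  have im: "v \<in> {dif ?K i *\<^sub>v w | w. w \<in> carrier_vec (rnk ?K (Suc i))} \<longleftrightarrow> (\<exists>w. v = kvec i (kd w))" for v i
  proof
    assume "v \<in> {dif ?K i *\<^sub>v w | w. w \<in> carrier_vec (rnk ?K (Suc i))}"
    then obtain w where w: "v = dif ?K i *\<^sub>v w" "w \<in> carrier_vec (card (ksets (Suc i) :: 'n set set))"
      by auto
    obtain x :: "'n set \<Rightarrow> ('n, 'k) mpol" where "w = kvec (Suc i) x" using exists_kvec[OF w(2)] by blast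
    then show "\<exists>w. v = kvec i (kd w)" using w(1) dif_kvec by blast
  next
    assume "\<exists>w. v = kvec i (kd w)"
    then obtain w :: "'n set \<Rightarrow> ('n, 'k) mpol" where "v = kvec i (kd w)" by blast
    then have "v = dif ?K i *\<^sub>v kvec (Suc i) w" by (simp add: dif_kvec)
    moreover have "kvec (Suc i) w \<in> carrier_vec (rnk ?K (Suc i))" by simp
    ultimately show "v \<in> {dif ?K i *\<^sub>v w | w. w \<in> carrier_vec (rnk ?K (Suc i))}" by blast
  qed
  have kd0: "kd w {} = (\<Sum>j\<in>UNIV. var j * w {j})" for w :: "'n set \<Rightarrow> ('n, 'k) mpol"
    by (simp add: kd_def ksign_def)
  have ker0: "{v \<in> carrier_vec (rnk ?K 0). ?e \<bullet> v \<in> maxideal} = {dif ?K 0 *\<^sub>v w | w. w \<in> carrier_vec (rnk ?K 1)}"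
  proof (intro Set.set_eqI)
    fix v
    have "v \<in> carrier_vec 1 \<and> v $ 0 \<in> maxideal \<longleftrightarrow> (\<exists>w. v = kvec 0 (kd w :: 'n set \<Rightarrow> ('n, 'k) mpol))"
    proof
      assume v: "v \<in> carrier_vec 1 \<and> v $ 0 \<in> maxideal"
      then obtain x :: "'n \<Rightarrow> ('n, 'k) mpol" where x: "v $ 0 = (\<Sum>j\<in>UNIV. var j * x j)"
        using maxideal_sum by blast
      \<comment> \<open>The coefficient of x_j is placed at \<open>{j}\<close>, from which
        \<open>THE\<close> recovers j; \<open>kd\<close> at the empty set reads singletons
        only.\<close>
      have "v = kvec 0 (kd (\<lambda>\<sigma>. x (THE j. \<sigma> = {j})))"
        using v x by (intro eq_vecI) (auto simp: kvec_def ksets_0 e0 kd0)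
      then show "\<exists>w. v = kvec 0 (kd w)" by blast
    next
      assume "\<exists>w. v = kvec 0 (kd w :: 'n set \<Rightarrow> ('n, 'k) mpol)"
      then obtain w :: "'n set \<Rightarrow> ('n, 'k) mpol" where w: "v = kvec 0 (kd w)" by blast
      then have "v $ 0 = (\<Sum>j\<in>UNIV. var j * w {j})" by (simp add: kvec_def ksets_0 e0 kd0)
      moreover have "lookup (var j) 0 = (0 :: 'k)" for j :: 'n
      proof -
        have "var j \<in> (maxideal :: ('n, 'k) mpol set)"
          unfolding maxideal_def by (rule mult_module.span_base) simp
        then show ?thesis by (simp add: maxideal_eq)
      qed
      ultimately have "v $ 0 \<in> maxideal" by (simp add: maxideal_eq lookup_sum lookup_mult_zero)
      then show "v \<in> carrier_vec 1 \<and> v $ 0 \<in> maxideal" by (simp add: w kvec_def ksets_0)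
    qed
    then show "v \<in> {v \<in> carrier_vec (rnk ?K 0). ?e \<bullet> v \<in> maxideal} \<longleftrightarrow>
        v \<in> {dif ?K 0 *\<^sub>v w | w. w \<in> carrier_vec (rnk ?K 1)}"
      using im[of v 0] ev[of v] r0 by auto
  qed
  have ker: "{v \<in> carrier_vec (rnk ?K (Suc i)). dif ?K i *\<^sub>v v = 0\<^sub>v (rnk ?K i)} =
      {dif ?K (Suc i) *\<^sub>v w | w. w \<in> carrier_vec (rnk ?K (Suc (Suc i)))}" (is "?L = ?R") for i
  proof (rule Set.equalityI; rule subsetI)
    fix v assume "v \<in> ?L"
    then show "v \<in> ?R" using koszul_exact[of v i] by auto
  next
    fix v assume "v \<in> ?R"
    then obtain w where v: "v = kvec (Suc i) (kd w :: 'n set \<Rightarrow> ('n, 'k) mpol)" using im by blast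
    have "dif ?K i *\<^sub>v v = kvec i (\<lambda>_. 0)" unfolding v dif_kvec by (simp add: kd_kd kvec_eq_iff)
    then show "v \<in> ?L" unfolding v using kvec_carrier by (simp add: kvec_zero)
  qed
  have gm: "graded_maps ?K" using graded_dif_koszul unfolding graded_maps_def graded_mat_def by blast
  have sur: "\<exists>v\<in>carrier_vec (rnk ?K 0). ?e \<bullet> v - s \<in> maxideal" for s
  proof (rule bexI[of _ "vec 1 (\<lambda>_. s)"])
    show "?e \<bullet> vec 1 (\<lambda>_. s) - s \<in> maxideal"
      by (subst ev) (simp_all add: maxideal_eq)
  qed (simp add: ksets_0)
  have hom: "homog (shift ?K 0 j) (?e $ j)" if "j < rnk ?K 0" for j
    using that by (simp add: ksets_0 e0 homog_def indic_def)
  show ?thesis unfolding free_resolution_K_def using gm r0 hom sur ker0 ker by auto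
qed


section \<open>Homological shift ideals and socles\<close>

lemma ksets_top: "ksets CARD('n) = {UNIV :: 'n::finite set}"
  by (auto simp: ksets_def dest: card_eq_UNIV_imp_eq_UNIV[OF finite])

lemma kd_const: "kd (\<lambda>_. f) (- {j}) = ksign j (- {j}) * (var j * f)"
  by (simp add: kd_def)

lemma ksign_mult_mem:
  assumes "mult_module.subspace J"
  shows "ksign j \<sigma> * f \<in> J \<longleftrightarrow> f \<in> (J :: ('n::finite, 'k::field) mpol set)"
proof
  assume "ksign j \<sigma> * f \<in> J"
  then have "ksign j \<sigma> * (ksign j \<sigma> * f) \<in> J" by (rule mult_module.subspace_scale[OF assms])
  then show "f \<in> J" by simp
qed (rule mult_module.subspace_scale[OF assms])

text \<open>
  By exactness an \<open>(n - 1)\<close>-cycle with entries in \<open>J\<close> is the boundary of a unique \<open>f \<in> S\<close>.  Its entries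
  are \<open>\<plusminus> x\<^sub>j f\<close>, so that \<open>f \<in> J : \<mm>\<close>, and it is a boundary over \<open>J\<close> iff \<open>f \<in> J\<close>.
\<close>

lemma Tor_nonzero_top:
  fixes A :: "'n::finite expo set"
  assumes n: "CARD('n) = Suc (Suc l)"
  shows "Tor_nonzero (Suc l) (ideal_gen (xpow ` A) :: ('n, 'k::field) mpol set) a \<longleftrightarrow>
    (\<exists>b\<in>socle_exps A. a = b + indic UNIV)"
proof
  let ?K = "koszul :: ('n, 'k) gr_complex" and ?J = "ideal_gen (xpow ` A) :: ('n, 'k) mpol set"
  have J: "mult_module.subspace ?J" by (rule mult_module.subspace_span)
  have top: "ksets (Suc (Suc l)) = {UNIV :: 'n set}" using ksets_top n by metis
  have e0: "kenum (Suc (Suc l)) 0 = (UNIV :: 'n set)"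
    using kenum_in[of 0 "Suc (Suc l)", where 'n = 'n] by (simp add: top)
  have co: "- {j} \<in> ksets (Suc l)" for j :: 'n
    using n by (simp add: ksets_def Compl_eq_Diff_UNIV card_Diff_singleton)
  {
    assume "Tor_nonzero (Suc l) ?J a"
    \<comment> \<open>The resolution behind \<open>Tor_nonzero\<close> is arbitrary, so the cycle is
      first moved to the Koszul complex.\<close>
    then obtain v where v: "v \<in> tensor_cycles ?K ?J (Suc l)" "homog_vec ?K (Suc l) a v"
      "v \<notin> tensor_boundaries ?K ?J (Suc l)"
      unfolding Tor_nonzero_def using Tor_transfer[OF _ free_resolution_koszul J] by blast
    have vc: "v \<in> carrier_vec (card (ksets (Suc l) :: 'n set set))"
      and vJ: "\<And>r. r < card (ksets (Suc l) :: 'n set set) \<Longrightarrow> v $ r \<in> ?J"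
      and cyc: "dif ?K l *\<^sub>v v = 0\<^sub>v (card (ksets l :: 'n set set))"
      using v(1) by (auto simp: tensor_cycles_def tensor_chains_def)
    obtain w where w: "w \<in> carrier_vec (rnk ?K (Suc (Suc l)))" "dif ?K (Suc l) *\<^sub>v w = v"
      using koszul_exact[OF vc cyc] by auto
    \<comment> \<open>A homogeneous preimage makes its single coefficient \<open>f\<close> a
      constant times a monomial.\<close>
    define x where "x = hpart ?K (Suc (Suc l)) a w"
    have x: "dif ?K (Suc l) *\<^sub>v x = v"
      using mult_mat_hpart[OF graded_dif_koszul w(1)] w(2) hpart_eq[OF v(2)] by (simp add: x_def)
    have xh: "homog_vec ?K (Suc (Suc l)) a x" unfolding x_def by (rule homog_vec_hpart)
    have xc: "x \<in> carrier_vec 1" using xh by (simp add: homog_vec_def top)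
    define f where "f = x $ 0"
    \<comment> \<open>In top degree the full set is the only basis element, so a constant function
      represents the coefficient and \<open>kd_const\<close> applies.\<close>
    have xf: "x = kvec (Suc (Suc l)) (\<lambda>_. f)"
      using xc by (intro eq_vecI) (auto simp: f_def kvec_def top)
    have fJ: "f \<notin> ?J"
    proof
      assume "f \<in> ?J"
      then have "x \<in> tensor_chains ?K ?J (Suc (Suc l))"
        using xc by (simp add: tensor_chains_def top f_def)
      then show False using v(3) x by (auto simp: tensor_boundaries_def)
    qed
    have fk: "m + indic UNIV = a" if "m \<in> keys f" for m
      using xh that by (auto simp: homog_vec_def top f_def e0)
    from fJ have "f \<noteq> 0" using mult_module.span_zero by metis
    then obtain b where b: "b \<in> keys f" by (metis equals0I keys_eq_empty)
    have "m = b" if "m \<in> keys f" for m using fk[OF that] fk[OF b] by (metis add_right_cancel)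
    with b have kf: "keys f = {b}" by blast
    have "var j * f \<in> ?J" for j
    proof -
      obtain r where r: "r < card (ksets (Suc l) :: 'n set set)" "kenum (Suc l) r = - {j}"
        using co by (rule kenum_obtain)
      have "v = kvec (Suc l) (kd (\<lambda>_. f))" using x dif_kvec xf by metis
      then have "v $ r = ksign j (- {j}) * (var j * f)" using r by (simp add: kd_const)
      then show ?thesis using vJ[OF r(1)] ksign_mult_mem[OF J] by metis
    qed
    moreover have "keys (var j * f) = {Poly_Mapping.single j 1 + b}" for j
      unfolding var_def keys_xpow_mult kf by simp
    ultimately have "Poly_Mapping.single j 1 + b \<in> up A" for j
      unfolding ideal_gen_xpow by (metis insert_subset mem_Collect_eq)
    moreover have "b \<notin> up A" using fJ kf by (simp add: ideal_gen_xpow)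
    ultimately have "b \<in> socle_exps A" by (simp add: socle_exps_def add.commute)
    with fk[OF b] show "\<exists>b\<in>socle_exps A. a = b + indic UNIV" by blast
  }
  {
    assume "\<exists>b\<in>socle_exps A. a = b + indic UNIV"
    then obtain b where b: "b \<in> socle_exps A" "a = b + indic UNIV" by blast
    let ?f = "xpow b :: ('n, 'k) mpol"
    let ?x = "kvec (Suc (Suc l)) (\<lambda>_. ?f)"
    define v where "v = dif ?K (Suc l) *\<^sub>v ?x"
    have vk: "v = kvec (Suc l) (kd (\<lambda>_. ?f))" by (simp add: v_def dif_kvec)
    have fj: "var j * ?f \<in> ?J" for j
    proof -
      have "keys (var j * ?f) = {Poly_Mapping.single j 1 + b}"
        unfolding var_def by (simp add: keys_xpow_mult)
      then show ?thesis using b(1) by (simp add: ideal_gen_xpow socle_exps_def add.commute)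
    qed
    then have "kd (\<lambda>_. ?f) \<sigma> \<in> ?J" for \<sigma>
      unfolding kd_def by (intro mult_module.subspace_sum[OF J] mult_module.subspace_scale[OF J, of "var _ * _"])
    then have vJ: "v \<in> tensor_chains ?K ?J (Suc l)" by (simp add: tensor_chains_def vk)
    have "dif ?K l *\<^sub>v v = kvec l (\<lambda>_. 0)" unfolding vk dif_kvec by (simp add: kd_kd kvec_eq_iff)
    then have "v \<in> tensor_cycles ?K ?J (Suc l)" using vJ by (simp add: tensor_cycles_def kvec_zero)
    moreover have "homog_vec ?K (Suc l) a v"
      unfolding v_def
      by (rule homog_vec_mult_mat[OF graded_dif_koszul]) (simp add: homog_vec_def top e0 b(2) kvec_def)
    moreover have "v \<notin> tensor_boundaries ?K ?J (Suc l)"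
    proof
      assume "v \<in> tensor_boundaries ?K ?J (Suc l)"
      then obtain w where w: "w \<in> tensor_chains ?K ?J (Suc (Suc l))" "v = dif ?K (Suc l) *\<^sub>v w"
        by (auto simp: tensor_boundaries_def)
      have wJ: "w \<in> carrier_vec 1" "w $ 0 \<in> ?J" using w(1) by (auto simp: tensor_chains_def top)
      have wk: "w = kvec (Suc (Suc l)) (\<lambda>_. w $ 0)"
        using wJ(1) by (intro eq_vecI) (auto simp: kvec_def top)
      fix j :: 'n
      have "kvec (Suc l) (kd (\<lambda>_. ?f)) = kvec (Suc l) (kd (\<lambda>_. w $ 0))"
        using w(2) vk dif_kvec wk by metis
      then have "ksign j (- {j}) * (var j * ?f) = ksign j (- {j}) * (var j * w $ 0)"
        using co[of j] by (simp add: kvec_eq_iff flip: kd_const)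
      then have "ksign j (- {j}) * (ksign j (- {j}) * (var j * ?f)) =
          ksign j (- {j}) * (ksign j (- {j}) * (var j * w $ 0))" by (rule arg_cong)
      then have "?f = w $ 0" by (simp add: var_mult_cancel)
      then have "?f \<in> ?J" using wJ(2) by simp
      then show False using b(1) by (simp add: ideal_gen_xpow socle_exps_def)
    qed
    ultimately show "Tor_nonzero (Suc l) ?J a"
      unfolding Tor_nonzero_def using free_resolution_koszul by blast
  }
qed

lemma HS_top:
  fixes A :: "'n::finite expo set"
  assumes "CARD('n) = Suc (Suc l)"
  shows "HS (CARD('n) - 1) (ideal_gen (xpow ` A) :: ('n, 'k::field) mpol set) =
    ideal_gen (xpow ` (\<lambda>b. b + indic UNIV) ` socle_exps A)"
proof -
  have "{xpow a :: ('n, 'k) mpol | a. Tor_nonzero (CARD('n) - 1) (ideal_gen (xpow ` A) :: ('n, 'k) mpol set) a}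
      = xpow ` (\<lambda>b. b + indic UNIV) ` socle_exps A"
    using Tor_nonzero_top[OF assms, of A, where 'k = 'k] assms by auto
  then show ?thesis unfolding HS_def by (rule arg_cong)
qed

section \<open>Degrees of monomials and the ideal HS_0\<close>

lemma mdeg_add: "mdeg (a + b) = mdeg a + mdeg b"
  by (simp add: mdeg_def lookup_add sum.distrib)

lemma mdeg_single [simp]: "mdeg (Poly_Mapping.single j 1) = 1"
  by (simp add: mdeg_def lookup_single when_def)

lemma mdeg_eq_0_iff: "mdeg a = 0 \<longleftrightarrow> a = 0"
  by (auto simp: mdeg_def poly_mapping_eq_iff fun_eq_iff)

text \<open>Tor_0(K, J) is J/mJ, which is nonzero exactly at the minimal monomial generators of
  J.\<close>

lemma HS_0:
  "HS 0 (ideal_gen (xpow ` A) :: ('n::finite, 'k::field) mpol set) = ideal_gen (xpow ` A)"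
proof
  let ?K = "koszul :: ('n, 'k) gr_complex" and ?J = "ideal_gen (xpow ` A) :: ('n, 'k) mpol set"
  let ?T = "{a. Tor_nonzero 0 ?J a}"
  have HS: "HS 0 ?J = {f. keys f \<subseteq> up ?T}"
    unfolding HS_def by (simp flip: ideal_gen_xpow add: setcompr_eq_image)
  \<comment> \<open>Over any resolution, a nonzero vector of multidegree a with entries in J has a
    term whose monomial lies in J and divides x^a; no comparison with the Koszul complex is
    made.\<close>
  have T1: "a \<in> up A" if T: "Tor_nonzero 0 ?J a" for a
  proof -
    obtain F e v where F: "free_resolution_K F e" and v: "v \<in> tensor_cycles F ?J 0"
      "homog_vec F 0 a v" "v \<notin> tensor_boundaries F ?J 0" using T by (auto simp: Tor_nonzero_def)
    have vc: "v \<in> carrier_vec (rnk F 0)" using v(2) by (simp add: homog_vec_def)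
    have "v \<noteq> 0\<^sub>v (rnk F 0)"
    proof
      assume "v = 0\<^sub>v (rnk F 0)"
      also have "\<dots> = dif F 0 *\<^sub>v 0\<^sub>v (rnk F (Suc 0))"
        using resolution_carrier(1)[OF F, of 0] by auto
      finally have "v \<in> tensor_boundaries F ?J 0"
        by (auto simp: tensor_boundaries_def tensor_chains_def mult_module.span_zero)
      with v(3) show False by blast
    qed
    then obtain r where r: "r < rnk F 0" "v $ r \<noteq> 0" using vc by (metis carrier_vecD eq_vecI index_zero_vec)
    then obtain m where m: "m \<in> keys (v $ r)" by (metis equals0I keys_eq_empty)
    have "m + shift F 0 r = a" using v(2) r(1) m by (auto simp: homog_vec_def)
    moreover have "v $ r \<in> ?J" using v(1) r(1) by (simp add: tensor_cycles_def tensor_chains_def)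
    then have "m \<in> up A" using m by (auto simp: ideal_gen_xpow)
    ultimately show ?thesis using up_add by blast
  qed
  \<comment> \<open>The Koszul boundaries in degree 0 have their entry in mJ, which misses the
    minimal generators.\<close>
  have T2: "Tor_nonzero 0 ?J b" if b: "b \<in> up A" "\<And>j c. b = Poly_Mapping.single j 1 + c \<Longrightarrow> c \<notin> up A" for b
  proof -
    have e0: "kenum 0 0 = ({} :: 'n set)" using kenum_in[of 0 0, where 'n = 'n] by (simp add: ksets_0)
    define v where "v = kvec 0 (\<lambda>_ :: 'n set. xpow b :: ('n, 'k) mpol)"
    have "v \<in> tensor_cycles ?K ?J 0"
      using b(1) by (simp add: tensor_cycles_def tensor_chains_def v_def ideal_gen_xpow)
    moreover have "homog_vec ?K 0 b v" by (simp add: homog_vec_def v_def kvec_def ksets_0 e0 indic_def)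
    moreover have "v \<notin> tensor_boundaries ?K ?J 0"
    proof
      assume "v \<in> tensor_boundaries ?K ?J 0"
      then obtain w where w: "w \<in> tensor_chains ?K ?J (Suc 0)" "v = dif ?K 0 *\<^sub>v w"
        by (auto simp: tensor_boundaries_def)
      obtain x where x: "w = kvec (Suc 0) x"
        using exists_kvec w(1) unfolding tensor_chains_def by (metis (no_types, lifting) koszul_simps(1) mem_Collect_eq)
      have xJ: "x {j} \<in> ?J" for j
      proof -
        have "{j} \<in> ksets (Suc 0)" by (simp add: ksets_def)
        then obtain r where "r < card (ksets (Suc 0) :: 'n set set)" "kenum (Suc 0) r = {j}" by (rule kenum_obtain)
        then show ?thesis using w(1) x by (auto simp: tensor_chains_def)
      qed
      have "kvec 0 (\<lambda>_. xpow b) = kvec 0 (kd x)" using w(2) x dif_kvec v_def by metis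
      then have "xpow b = kd x {}" by (simp add: kvec_eq_iff ksets_0)
      then have "xpow b = (\<Sum>j\<in>UNIV. ksign j {} * (var j * x {j}))" by (simp add: kd_def)
      then have "b \<in> keys (\<Sum>j\<in>UNIV. ksign j {} * (var j * x {j}))" by (metis keys_xpow singletonI)
      then obtain j where "b \<in> keys (ksign j {} * (var j * x {j}))"
        using Poly_Mapping.keys_sum by fastforce
      then obtain c where "b = Poly_Mapping.single j 1 + c" "c \<in> keys (x {j})"
        by (auto simp: keys_ksign_mult var_def keys_xpow_mult)
      with xJ[of j] b(2) show False by (auto simp: ideal_gen_xpow)
    qed
    ultimately show ?thesis unfolding Tor_nonzero_def using free_resolution_koszul by blast
  qed
  \<comment> \<open>Dividing by variables while staying in J ends at a minimal generator, where
    \<open>T2\<close> applies.\<close>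
  have "a \<in> up ?T" if "a \<in> up A" for a
    using that
  proof (induction "mdeg a" arbitrary: a rule: less_induct)
    case less
    show ?case
    proof (cases "\<exists>j c. a = Poly_Mapping.single j 1 + c \<and> c \<in> up A")
      case True
      then obtain j c where c: "a = Poly_Mapping.single j 1 + c" "c \<in> up A" by blast
      then have "mdeg c < mdeg a" unfolding c(1) mdeg_add mdeg_single by simp
      then have "c \<in> up ?T" using less.hyps c(2) by blast
      then show ?thesis using c(1) up_add' by blast
    next
      case False
      then show ?thesis using T2[OF less.prems] subset_up by blast
    qed
  qed
  then show "?J \<subseteq> HS 0 ?J" unfolding HS by (auto simp: ideal_gen_xpow)
  have "up ?T \<subseteq> up A" using T1 up_add unfolding up_def by blast
  then show "HS 0 ?J \<subseteq> ?J" unfolding HS by (auto simp: ideal_gen_xpow)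
qed

section \<open>Powers of a monomial ideal generated in one degree\<close>

primrec sumset_pow :: "'n expo set \<Rightarrow> nat \<Rightarrow> 'n expo set" where
  "sumset_pow A 0 = {0}"
| "sumset_pow A (Suc k) = sumset A (sumset_pow A k)"

lemma ideal_pow_xpow:
  "ideal_pow (ideal_gen (xpow ` A)) k = (ideal_gen (xpow ` sumset_pow A k) :: ('n, 'k::field) mpol set)"
proof (induction k)
  case 0
  have "up {0 :: 'n expo} = UNIV" by (auto simp: up_def)
  then show ?case by (simp only: ideal_gen_xpow) simp
qed (simp add: ideal_mult_xpow)

text \<open>Different products of generators may give the same monomial, so the multiset of factors
  is made explicit; Dickson's lemma acts on these multisets.\<close>

lemma sumset_pow_mset: "sumset_pow A k = {sum_mset M | M. set_mset M \<subseteq> A \<and> size M = k}"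
proof (induction k)
  case (Suc k)
  show ?case
  proof (intro Set.set_eqI iffI)
    fix x assume "x \<in> sumset_pow A (Suc k)"
    then obtain a M where "a \<in> A" "set_mset M \<subseteq> A" "size M = k" "x = a + sum_mset M"
      by (auto simp: sumset_def Suc)
    then show "x \<in> {sum_mset M | M. set_mset M \<subseteq> A \<and> size M = Suc k}"
      by (intro CollectI exI[of _ "add_mset a M"]) auto
  next
    fix x assume "x \<in> {sum_mset M | M. set_mset M \<subseteq> A \<and> size M = Suc k}"
    then obtain M where M: "x = sum_mset M" "set_mset M \<subseteq> A" "size M = Suc k" by blast
    then obtain a N where "M = add_mset a N" by (metis size_eq_Suc_imp_eq_union)
    with M show "x \<in> sumset_pow A (Suc k)" by (auto simp: sumset_def Suc)
  qed
qed simp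

lemma mdeg_sumset_pow:
  assumes "\<And>a. a \<in> A \<Longrightarrow> mdeg a = d" "x \<in> sumset_pow A k"
  shows "mdeg x = d * k"
  using assms(2)
proof (induction k arbitrary: x)
  case 0
  then show ?case by (simp add: mdeg_eq_0_iff)
next
  case (Suc k)
  then obtain a y where "a \<in> A" "y \<in> sumset_pow A k" "x = a + y" by (auto simp: sumset_def)
  with Suc.IH assms(1) show ?case by (simp add: mdeg_add)
qed

text \<open>
  If \<open>A\<close> generates \<open>I\<close> and lies in degree \<open>d\<close>, these are the socle exponents of \<open>I\<^sup>k\<close> of degree \<open>dk - 1\<close>.
\<close>

definition top_socle :: "'n::finite expo set \<Rightarrow> nat \<Rightarrow> 'n expo set"
  where "top_socle A k = {u. \<forall>j. u + Poly_Mapping.single j 1 \<in> sumset_pow A k}"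

lemma top_socle_mset:
  assumes u: "u \<in> top_socle A k" and M: "set_mset M \<subseteq> A"
  shows "u + sum_mset M \<in> top_socle A (k + size M)"
  using M
proof (induction M)
  case (add a M)
  have "(u + sum_mset (add_mset a M)) + Poly_Mapping.single j 1 \<in> sumset_pow A (Suc (k + size M))" for j
  proof -
    have "(u + sum_mset M) + Poly_Mapping.single j 1 \<in> sumset_pow A (k + size M)"
      using add by (auto simp: top_socle_def)
    moreover have "(u + sum_mset (add_mset a M)) + Poly_Mapping.single j 1 =
      a + ((u + sum_mset M) + Poly_Mapping.single j 1)" by (simp add: ac_simps)
    ultimately show ?thesis using add.prems by (auto simp: sumset_def)
  qed
  then show ?case by (simp add: top_socle_def)
qed (use u in simp)

text \<open>No socle monomial properly divides another, so each is a minimal generator of the socle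
  and has degree dk - 1 by hypothesis. Conversely, a monomial of degree dk - 1 is too small to lie
  in I^k.\<close>

lemma socle_exps_eq_top_socle:
  fixes A :: "'n::finite expo set"
  assumes d: "\<And>a. a \<in> A \<Longrightarrow> mdeg a = d"
    and soc: "monomial_ideal_in_degree (int d * int k - 1)
      (soc (ideal_gen (xpow ` sumset_pow A k) :: ('n, 'k::field) mpol set))"
  shows "socle_exps (sumset_pow A k) = top_socle A k"
proof -
  obtain B where B: "\<And>b. b \<in> B \<Longrightarrow> int (mdeg b) = int d * int k - 1"
    "(ideal_gen (xpow ` socle_exps (sumset_pow A k)) :: ('n, 'k) mpol set) = ideal_gen (xpow ` B)"
    using soc unfolding soc_eq monomial_ideal_in_degree_def by blast
  have up: "up (socle_exps (sumset_pow A k)) = up B"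
  proof (rule Set.set_eqI)
    fix m
    have "(xpow m :: ('n, 'k) mpol) \<in> ideal_gen (xpow ` socle_exps (sumset_pow A k)) \<longleftrightarrow>
      (xpow m :: ('n, 'k) mpol) \<in> ideal_gen (xpow ` B)" by (simp only: B(2))
    then show "m \<in> up (socle_exps (sumset_pow A k)) \<longleftrightarrow> m \<in> up B" by (simp add: ideal_gen_xpow)
  qed
  have degup: "mdeg x \<ge> d * k" if "x \<in> up (sumset_pow A k)" for x
    using that mdeg_sumset_pow[OF d] by (auto simp: up_def mdeg_add)
  \<comment> \<open>In degree dk the cofactor of a generator of I^k has degree 0.\<close>
  have upk: "x \<in> sumset_pow A k" if x: "x \<in> up (sumset_pow A k)" "mdeg x = d * k" for x
  proof -
    obtain y z where y: "y \<in> sumset_pow A k" "x = y + z" using x(1) by (auto simp: up_def)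
    then have "mdeg z = 0" using mdeg_sumset_pow[OF d y(1)] x(2) by (simp add: mdeg_add)
    then show ?thesis using y by (simp add: mdeg_eq_0_iff)
  qed
  show ?thesis
  proof (intro Set.set_eqI iffI)
    fix u assume u: "u \<in> socle_exps (sumset_pow A k)"
    then have "u \<in> up B" using subset_up up by blast
    then obtain b c where b: "b \<in> B" "u = b + c" by (auto simp: up_def)
    then have "b \<in> up (socle_exps (sumset_pow A k))" using subset_up up by blast
    then obtain s c' where s: "s \<in> socle_exps (sumset_pow A k)" "b = s + c'" by (auto simp: up_def)
    \<comment> \<open>Both \<open>s\<close> and \<open>u\<close> are socle exponents, and a proper
      multiple of x^s already lies in I^k.\<close>
    have "c' + c = 0"
    proof (rule ccontr)
      assume "c' + c \<noteq> 0"
      then obtain j q where "c' + c = Poly_Mapping.single j 1 + q" by (rule ex_single_add)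
      then have "u = (s + Poly_Mapping.single j 1) + q" using b(2) s(2) by (simp add: add.assoc)
      then have "u \<in> up (sumset_pow A k)" using s(1) up_add by (auto simp: socle_exps_def)
      with u show False by (simp add: socle_exps_def)
    qed
    then have "mdeg c = 0" using mdeg_add[of c' c] mdeg_eq_0_iff[of "c' + c"] by simp
    then have "u = b" using b(2) by (simp add: mdeg_eq_0_iff)
    \<comment> \<open>The equation is stated over the integers with 1 added on the left, which
      avoids a truncated dk - 1.\<close>
    then have du: "int (mdeg u) + 1 = int (d * k)" using B(1)[OF b(1)] by simp
    have "u + Poly_Mapping.single j 1 \<in> sumset_pow A k" for j
    proof (rule upk)
      show "u + Poly_Mapping.single j 1 \<in> up (sumset_pow A k)" using u by (simp add: socle_exps_def)
      show "mdeg (u + Poly_Mapping.single j 1) = d * k"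
        unfolding mdeg_add mdeg_single using du by linarith
    qed
    then show "u \<in> top_socle A k" by (simp add: top_socle_def)
  next
    fix u assume u: "u \<in> top_socle A k"
    fix j0 :: 'n
    have "mdeg (u + Poly_Mapping.single j0 1) = d * k"
      using u by (intro mdeg_sumset_pow[OF d]) (auto simp: top_socle_def)
    then have "mdeg u < d * k" unfolding mdeg_add mdeg_single by simp
    then have "u \<notin> up (sumset_pow A k)" using degup by force
    then show "u \<in> socle_exps (sumset_pow A k)"
      using u subset_up by (auto simp: socle_exps_def top_socle_def)
  qed
qed

section \<open>Dickson's lemma\<close>

text \<open>A monotone subsequence exists; if it is decreasing, it is constant from the index of its
  least value on, hence weakly increasing there.\<close>

lemma exists_mono_subsequence_nat:
  fixes f :: "nat \<Rightarrow> nat"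
  shows "\<exists>r :: nat \<Rightarrow> nat. strict_mono r \<and> mono (f \<circ> r)"
proof -
  obtain r where r: "strict_mono r" "monoseq (\<lambda>n. f (r n))" using seq_monosub[of f] by blast
  show ?thesis
  proof (cases "\<forall>m n. m \<le> n \<longrightarrow> f (r m) \<le> f (r n)")
    case True
    then show ?thesis using r(1) by (intro exI[of _ r]) (auto simp: mono_def)
  next
    case False
    then have dec: "f (r n) \<le> f (r m)" if "m \<le> n" for m n
      using r(2) that by (auto simp: monoseq_def)
    obtain N where N: "\<And>n. f (r N) \<le> f (r n)"
      using ex_has_least_nat[of "\<lambda>_. True" 0 "\<lambda>n. f (r n)"] by auto
    have "f (r (n + N)) = f (r N)" for n using N dec[of N "n + N"] by (simp add: le_antisym)
    moreover have "strict_mono (\<lambda>n. r (n + N))" using r(1) by (simp add: strict_mono_def)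
    ultimately show ?thesis by (intro exI[of _ "\<lambda>n. r (n + N)"]) (simp add: mono_def)
  qed
qed

text \<open>Coordinates are treated one after the other; thinning out preserves the monotonicity
  already obtained.\<close>

lemma dickson_subsequence:
  fixes f :: "nat \<Rightarrow> 'a \<Rightarrow> nat"
  assumes "finite A"
  shows "\<exists>r :: nat \<Rightarrow> nat. strict_mono r \<and> (\<forall>x\<in>A. mono (\<lambda>n. f (r n) x))"
  using assms
proof (induction A)
  case empty
  show ?case by (intro exI[of _ id]) (simp add: strict_mono_def)
next
  case (insert a A)
  then obtain r :: "nat \<Rightarrow> nat" where r: "strict_mono r" "\<And>x. x \<in> A \<Longrightarrow> mono (\<lambda>n. f (r n) x)" by blast
  obtain s :: "nat \<Rightarrow> nat" where s: "strict_mono s" "mono ((\<lambda>n. f (r n) a) \<circ> s)"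
    using exists_mono_subsequence_nat by blast
  have "mono (\<lambda>n. f ((r \<circ> s) n) x)" if "x \<in> insert a A" for x
  proof (cases "x = a")
    case True
    then show ?thesis using s(2) by (simp add: comp_def)
  next
    case False
    then have "mono (\<lambda>n. f (r n) x)" using r(2) that by blast
    then show ?thesis using strict_mono_mono[OF s(1)] by (simp add: mono_def)
  qed
  moreover have "strict_mono (r \<circ> s)" using r(1) s(1) by (simp add: strict_mono_def)
  ultimately show ?case by blast
qed

section \<open>Stabilization of the socles\<close>

lemma finite_mdeg: "finite {a :: 'n::finite expo. mdeg a = d}"
proof (rule finite_imageD)
  have "lookup ` {a :: 'n expo. mdeg a = d} \<subseteq> {f. \<forall>j. f j \<in> {..d}}"
    unfolding mdeg_def using member_le_sum[of _ "UNIV :: 'n set"] by fastforce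
  moreover have "finite {f :: 'n \<Rightarrow> nat. \<forall>j. f j \<in> {..d}}"
    using finite_set_of_finite_funs[of "UNIV :: 'n set" "{..d}" 0] by simp
  ultimately show "finite (lookup ` {a :: 'n expo. mdeg a = d})" by (rule finite_subset)
  show "inj_on lookup {a :: 'n expo. mdeg a = d}" by (rule inj_onI) (simp only: lookup_inject)
qed

text \<open>Otherwise there are counterexamples at arbitrarily high levels. Two of them have nested
  multisets, and the larger is then the smaller plus generators, so it does come from the level
  below.\<close>

lemma top_socle_Suc_eventually:
  fixes A :: "'n::finite expo set"
  assumes A: "finite A"
  shows "\<forall>\<^sub>F k in sequentially. top_socle A (Suc k) = sumset A (top_socle A k)"
proof (rule ccontr)
  have sub: "sumset A (top_socle A k) \<subseteq> top_socle A (Suc k)" for k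
  proof
    fix x assume "x \<in> sumset A (top_socle A k)"
    then obtain a u where "a \<in> A" "u \<in> top_socle A k" "x = a + u" by (auto simp: sumset_def)
    then show "x \<in> top_socle A (Suc k)" using top_socle_mset[of u A k "{#a#}"] by (simp add: add.commute)
  qed
  fix j0 :: 'n
  let ?e = "Poly_Mapping.single j0 1 :: 'n expo"
  define P where "P k u M \<longleftrightarrow> u \<in> top_socle A (Suc k) \<and> u \<notin> sumset A (top_socle A k) \<and>
    set_mset M \<subseteq> A \<and> size M = Suc k \<and> u + ?e = sum_mset M" for k u M
  assume "\<not> (\<forall>\<^sub>F k in sequentially. top_socle A (Suc k) = sumset A (top_socle A k))"
  then have "\<exists>k\<ge>N. top_socle A (Suc k) \<noteq> sumset A (top_socle A k)" for N
    by (auto simp: eventually_sequentially)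
  then have "\<exists>k\<ge>N. \<exists>u M. P k u M" for N
  proof -
    obtain k where k: "k \<ge> N" "top_socle A (Suc k) \<noteq> sumset A (top_socle A k)"
      using \<open>\<exists>k\<ge>N. _\<close> by blast
    then obtain u where u: "u \<in> top_socle A (Suc k)" "u \<notin> sumset A (top_socle A k)" using sub by blast
    then have "u + ?e \<in> sumset_pow A (Suc k)" by (simp add: top_socle_def)
    then obtain M where "set_mset M \<subseteq> A" "size M = Suc k" "u + ?e = sum_mset M"
      unfolding sumset_pow_mset by blast
    with u k(1) show ?thesis unfolding P_def by blast
  qed
  then obtain K u M where K: "\<And>N. K N \<ge> N" and P: "\<And>N. P (K N) (u N) (M N)" by metis
  obtain r :: "nat \<Rightarrow> nat" where r: "strict_mono r" "\<And>x. x \<in> A \<Longrightarrow> mono (\<lambda>n. count (M (r n)) x)"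
    using dickson_subsequence[OF A, of "\<lambda>n. count (M n)"] by blast
  define p where "p = r 0"
  \<comment> \<open>As K q \<ge> q \<ge> n, this choice forces K q > K p, so that the difference
    \<open>N\<close> of the multisets is not empty.\<close>
  define n where "n = Suc (K p)"
  define q where "q = r n"
  have "n \<le> q" unfolding q_def by (rule seq_suble[OF r(1)])
  then have Kq: "K q > K p" using K[of q] by (simp add: n_def)
  have "M p \<subseteq># M q"
  proof (rule mset_subset_eqI)
    fix x
    show "count (M p) x \<le> count (M q) x"
    proof (cases "x \<in> A")
      case True
      then show ?thesis using r(2)[OF True] unfolding p_def q_def mono_def by blast
    next
      case False
      then have "x \<notin># M p" using P[of p] unfolding P_def by blast
      then show ?thesis by (simp add: not_in_iff)
    qed
  qed
  then obtain N where N: "M q = M p + N" by (metis subset_mset.add_diff_inverse)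
  have sizes: "size (M p) = Suc (K p)" "size (M q) = Suc (K q)" using P unfolding P_def by blast+
  then have "size N = K q - K p" using N Kq by simp
  then have "N \<noteq> {#}" using Kq by auto
  then obtain a N' where N': "N = add_mset a N'" by (metis multiset_cases)
  have NA: "a \<in> A" "set_mset N' \<subseteq> A" using P[of q] N N' unfolding P_def by auto
  have "u q + ?e = (a + (u p + sum_mset N')) + ?e"
  proof -
    have "u q + ?e = sum_mset (M p) + (a + sum_mset N')" using P[of q] N N' unfolding P_def by (simp add: add.left_commute)
    also have "sum_mset (M p) = u p + ?e" using P[of p] unfolding P_def by simp
    finally show ?thesis by (simp add: ac_simps)
  qed
  then have "u q = a + (u p + sum_mset N')" by (metis add_right_cancel)
  \<comment> \<open>With \<open>a\<close> split off, the sizes give Suc (K p) + size N' = K q, one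
    below the level of \<open>u q\<close>.\<close>
  moreover have "u p + sum_mset N' \<in> top_socle A (K q)"
  proof -
    have "u p \<in> top_socle A (Suc (K p))" using P[of p] unfolding P_def by blast
    from top_socle_mset[OF this NA(2)] show ?thesis using sizes N N' by simp
  qed
  ultimately have "u q \<in> sumset A (top_socle A (K q))" using NA(1) unfolding sumset_def by blast
  then show False using P[of q] unfolding P_def by blast
qed

theorem proposition1p5:
  fixes I :: "(('n::finite \<Rightarrow>\<^sub>0 nat) \<Rightarrow>\<^sub>0 'k::field) set" and d :: nat
  assumes "monomial_ideal_in_degree (int d) I"
    and "\<forall>\<^sub>F k in sequentially.
           monomial_ideal_in_degree (int d * int k - 1) (soc (ideal_pow I k))"
  shows "\<forall>\<^sub>F k in sequentially.
           HS (CARD('n) - 1) (ideal_pow I (k + 1))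
             = ideal_mult I (HS (CARD('n) - 1) (ideal_pow I k))"
proof -
  obtain A where A: "\<And>a. a \<in> A \<Longrightarrow> mdeg a = d" "I = ideal_gen (xpow ` A)"
    using assms(1) unfolding monomial_ideal_in_degree_def by auto
  have pow: "ideal_pow I k = ideal_gen (xpow ` sumset_pow A k)" for k
    unfolding A(2) by (rule ideal_pow_xpow)
  show ?thesis
  proof (cases "CARD('n) = 1")
    case True
    have HS: "HS (CARD('n) - 1) (ideal_pow I k) = ideal_pow I k" for k
      unfolding pow by (simp add: True HS_0)
    show ?thesis unfolding HS by simp
  next
    case False
    have "CARD('n) \<noteq> 0" by simp
    with False obtain l where l: "CARD('n) = Suc (Suc l)" by (metis One_nat_def not0_implies_Suc)
    have "finite A" by (rule finite_subset[OF _ finite_mdeg[of d]]) (use A(1) in auto)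
    \<comment> \<open>The description of the socle is needed at k and at k + 1 together, hence the
      hypothesis for all larger exponents.\<close>
    from top_socle_Suc_eventually[OF this] assms(2)
      eventually_all_ge_at_top[OF assms(2)]
    show ?thesis
    proof eventually_elim
      case (elim k)
      have soc: "socle_exps (sumset_pow A m) = top_socle A m" if "m \<ge> k" for m
        using elim(3) that pow by (intro socle_exps_eq_top_socle[OF A(1), where 'k = 'k]) auto
      let ?s = "(\<lambda>b. b + indic UNIV) :: 'n expo \<Rightarrow> 'n expo"
      have HS: "HS (CARD('n) - 1) (ideal_pow I m) = ideal_gen (xpow ` ?s ` top_socle A m)" if "m \<ge> k" for m
        unfolding pow HS_top[OF l] soc[OF that] ..
      have "?s ` sumset A (top_socle A k) = sumset A (?s ` top_socle A k)"
      proof -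
        have "sumset A B = (\<lambda>(a, b). a + b) ` (A \<times> B)" for B :: "'n expo set"
          unfolding sumset_def by fast
        then show ?thesis by (force simp: image_image add.assoc)
      qed
      then have "HS (CARD('n) - 1) (ideal_pow I (k + 1)) = ideal_gen (xpow ` sumset A (?s ` top_socle A k))"
        using HS[of "k + 1"] elim(1) by simp
      also have "\<dots> = ideal_mult I (HS (CARD('n) - 1) (ideal_pow I k))"
        unfolding HS[OF order_refl] unfolding A(2) by (rule ideal_mult_xpow[symmetric])
      finally show ?case .
    qed
  qed
qed

end
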